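(* The operation $\cdot_R$ (multiplication of decimals) on the canonical encoding $X_R$ of decimals is weakly computable.
   Context: $\mathbb{N}=\{1,2,\dots\}$, $\mathbb{N}_0=\{0,1,2,\dots\}$, $D=\{0,1,\dots,9\}$. **Decimals.** A decimal is a formal infinite linear combination $d=(-)\sum_{n\le k}d_n10^n$ with an optional minus sign, $k\in\mathbb{N}_0$ (the order of $d$), $n\in\mathbb{Z}$, $d_n\in D$, such that (i) $d_k=0$ implies $k=0$; (ii) there is no $n\le k$ with $d_m=9$ for all $m\le n$; (iii) $-\sum_{n\le 0}0\cdot10^n$ is not allowed. Digits $d_n$ with $n>k$ are set to $0$. Two decimals are equal iff they have equal signs, orders and digits. $\mathbb{R}$ denotes the set of decimals. **Multiplication of decimals.** Let $\mathbb{Q}_D\subset\mathbb{Q}$ be the subring of fractions with a finite decimal expansion. For a decimal $d=(-)\sum_{n\le k}d_n10^n\in\mathbb{R}$ of order $k$ and $m\in\mathbb{N}$ let $r(d\,|\,m)=\pm\sum_{-m\le n\le k}d_n10^n\in\mathbb{Q}_D$ (with the sign of $d$) be the value of the $m$-th truncation of $d$. A sequence $(a_n)\subset\mathbb{Q}_D$ is Cauchy if for every $k\in\mathbb{N}$ there is $n_0\in\mathbb{N}$ with $|a_m-a_n|<1/k$ for all $m,n\ge n_0$. A Cauchy sequence $(a_n)\subset\mathbb{Q}_D$ generates $d$, written $d=G(a_n)$, if for every $k\in\mathbb{N}$ there is $n_0\in\mathbb{N}$ such that $|r(d\,|\,n)-a_n|<1/k$ for all $n\ge n_0$. Every decimal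 has a generating sequence and every Cauchy sequence in $\mathbb{Q}_D$ generates exactly one decimal. For $d=G(a_n)$, $e=G(b_n)$ one defines $d\cdot_Re:=G(a_nb_n)$ (independent of the choice of generating sequences). **Encodings and operations.** For a nonempty finite alphabet $A$ let $A^{\infty}=A^{\mathbb{N}_0}$ be the set of one-way infinite words over $A$. An encoding is a nonempty subset $X\subset A^\infty$. An operation on $X$ is a map $F\colon X\times X\to X$. **Canonical encoding $X_R$.** Let $A=D\cup\{-,\xi\}$, with $\xi$ a separation symbol. A decimal $d=(-)\sum_{n\le k}d_n10^n$ of order $k$ is encoded as the word $u(d)\in A^\infty$ consisting of the minus sign if $d$ has one, then the binary digits of $k$ (least significant digit first; $0$ is written as the single digit $0$), then $\xi$, then the digits $d_k,d_{k-1},d_{k-2},\dots$ in this order. $X_R=\{u(d)\mid d\in\mathbb{R}\}$, and $\cdot_R$ is transported to $X_R$ via the bijection $d\mapsto u(d)$. **Machines.** A machine $M$ (for an encoding $X\subset A^\infty$) is a Turing machine with a finite set of states containing an initial state and a terminal state, and with a finite alphabet $A'\supset A\cup\{0,1,\epsilon\}$, where $\epsilon\in A'\setminus A$ is the empty cell symbol. It operates on three bi-infinite tapes $T_1,T_2,T_3$, with cells labeled by $\mathbb{Z}$, via corresponding heads $H_1,H_2,H_3$; $H_1,H_2$ only read, $H_3$ reads and writes. The words $x=x_0x_1\dots$ and $y=y_0y_1\dots$ in $X$ are stored on $T_1$ and $T_2$, respectively, with the $n$-th letter in cell $n$ and $\epsilon$ in every cell $n<0$; finite numerical input is stored in binary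 on $T_3$ starting at cell $0$, least significant digit first, the remaining cells containing $\epsilon$. The computation starts in the initial state with every head at cell $0$. In each step, if $M$ is in the terminal state the computation terminates; otherwise, depending only on the current state and the contents of the three currently scanned cells, $M$ rewrites the scanned cell of $T_3$, moves each head by $-1$, $0$ or $+1$, and passes to a new (possibly the same) state, according to its finite instruction table. **Weak computability.** A machine $M$ weakly computes an operation $F\colon X\times X\to X$ if for every pair $(x,y)\in X^2$ there exists a number $h=h(x,y)\in\mathbb{N}$ such that for every $m\in\mathbb{N}_0$ the computation of $M$ on the input with $x$ on $T_1$, $y$ on $T_2$, and both $m$ and $h$ in binary on $T_3$ (in a fixed layout, e.g. $m$, a separating symbol, $h$) terminates with $z_m$ in cell $0$ of $T_3$ and $\epsilon$ in all other cells of $T_3$, where $F(x,y)=z_0z_1z_2\dots$. (The number $h$ may depend on $(x,y)$ but not on $m$; no computability of $h$ is required.) $F$ is weakly computable if some machine weakly computes it. *)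

theory Defs
  imports Complex_Main "HOL-Library.Omega_Words_Fun"
begin

section \<open>Decimals\<close>

text \<open>
  A decimal is a sign (\<^term>\<open>True\<close> for a minus sign), an order \<open>k\<close> and a digit function on the
  integers, where the digits beyond the order are set to \<open>0\<close>.
\<close>

definition is_decimal :: "bool \<Rightarrow> nat \<Rightarrow> (int \<Rightarrow> nat) \<Rightarrow> bool" where
  "is_decimal s k d \<longleftrightarrow>
     (\<forall>n. d n \<in> {0..9}) \<and>
     (\<forall>n > int k. d n = 0) \<and>
     (d (int k) = 0 \<longrightarrow> k = 0) \<and>
     \<not> (\<exists>n \<le> int k. \<forall>m \<le> n. d m = 9) \<and>
     \<not> (s \<and> k = 0 \<and> (\<forall>n \<le> 0. d n = 0))"

typedef decimal = "{(s, k, d). is_decimal s k d}"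
proof
  show "(False, 0, \<lambda>_. 0) \<in> {(s, k, d). is_decimal s k d}"
    by (auto simp: is_decimal_def)
qed

definition dec_neg :: "decimal \<Rightarrow> bool" where
  "dec_neg d = fst (Rep_decimal d)"

definition dec_order :: "decimal \<Rightarrow> nat" where
  "dec_order d = fst (snd (Rep_decimal d))"

definition dec_digit :: "decimal \<Rightarrow> int \<Rightarrow> nat" where
  "dec_digit d = snd (snd (Rep_decimal d))"

section \<open>Multiplication of decimals\<close>

definition Q_D :: "rat set" where
  "Q_D = {q. \<exists>(a::int) (n::nat). q = of_int a / 10 ^ n}"

definition truncation :: "decimal \<Rightarrow> nat \<Rightarrow> rat" where
  "truncation d m = (if dec_neg d then -1 else 1) *
     (\<Sum>n\<in>{- int m..int (dec_order d)}. of_nat (dec_digit d n) * 10 powi n)"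

text \<open>
  Sequences are indexed by \<open>1, 2, \<dots>\<close>; the value at index \<open>0\<close> is ignored throughout.
\<close>

definition cauchy_Q_D :: "(nat \<Rightarrow> rat) \<Rightarrow> bool" where
  "cauchy_Q_D a \<longleftrightarrow> (\<forall>n\<ge>1. a n \<in> Q_D) \<and>
     (\<forall>k\<ge>1. \<exists>n0\<ge>1. \<forall>m\<ge>n0. \<forall>n\<ge>n0. \<bar>a m - a n\<bar> < 1 / of_nat k)"

definition generates :: "(nat \<Rightarrow> rat) \<Rightarrow> decimal \<Rightarrow> bool" where
  "generates a d \<longleftrightarrow> cauchy_Q_D a \<and>
     (\<forall>k\<ge>1. \<exists>n0\<ge>1. \<forall>n\<ge>n0. \<bar>truncation d n - a n\<bar> < 1 / of_nat k)"

definition decimal_mult :: "decimal \<Rightarrow> decimal \<Rightarrow> decimal" where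
  "decimal_mult d e =
     (THE z. \<exists>a b. generates a d \<and> generates b e \<and> generates (\<lambda>n. a n * b n) z)"

section \<open>Symbols, encodings, operations\<close>

text \<open>
  A fixed infinite supply of symbols, from which all finite alphabets are taken:
  digits and auxiliary tape symbols indexed by natural numbers, the minus sign,
  the separation symbol and the empty cell symbol.
\<close>

datatype symbol = Digit nat | Minus | Sep | Blank | Aux nat

definition is_encoding :: "symbol set \<Rightarrow> symbol word set \<Rightarrow> bool" where
  "is_encoding A X \<longleftrightarrow> finite A \<and> A \<noteq> {} \<and> Blank \<notin> A \<and> X \<noteq> {} \<and> (\<forall>x\<in>X. range x \<subseteq> A)"

definition is_operation :: "symbol word set \<Rightarrow> (symbol word \<Rightarrow> symbol word \<Rightarrow> symbol word) \<Rightarrow> bool" where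
  "is_operation X F \<longleftrightarrow> (\<forall>x\<in>X. \<forall>y\<in>X. F x y \<in> X)"

text \<open>Binary digits, least significant first; \<open>0\<close> is written as a single digit.\<close>

fun binary :: "nat \<Rightarrow> symbol list" where
  "binary n = (if n < 2 then [Digit n] else Digit (n mod 2) # binary (n div 2))"

declare binary.simps [simp del]

section \<open>The canonical encoding\<close>

definition A_R :: "symbol set" where
  "A_R = Digit ` {0..9} \<union> {Minus, Sep}"

definition encode :: "decimal \<Rightarrow> symbol word" where
  "encode d = ((if dec_neg d then [Minus] else []) @ binary (dec_order d) @ [Sep]) \<frown>
     (\<lambda>i. Digit (dec_digit d (int (dec_order d) - int i)))"

definition X_R :: "symbol word set" where
  "X_R = range encode"

definition mult_R :: "symbol word \<Rightarrow> symbol word \<Rightarrow> symbol word" where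
  "mult_R x y = encode (decimal_mult (inv encode x) (inv encode y))"

section \<open>Machines\<close>

text \<open>
  \<open>instr q a b c = (q', c', i, j, l)\<close>: in state \<open>q\<close>, scanning \<open>a\<close>, \<open>b\<close>, \<open>c\<close> on the tapes 1, 2, 3,
  the machine writes \<open>c'\<close> on tape 3, moves the three heads by \<open>i\<close>, \<open>j\<close>, \<open>l\<close> and passes to \<open>q'\<close>.
\<close>

record 'q machine =
  states :: "'q set"
  initial :: 'q
  terminal :: 'q
  tape_alphabet :: "symbol set"
  instr :: "'q \<Rightarrow> symbol \<Rightarrow> symbol \<Rightarrow> symbol \<Rightarrow> 'q \<times> symbol \<times> int \<times> int \<times> int"

text \<open>
  \<^const>\<open>Sep\<close> is required among the tape symbols because it separates the two numbers in the
  input on tape 3. Values of \<^const>\<open>instr\<close> outside the finite table are irrelevant.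
\<close>

definition is_machine :: "symbol set \<Rightarrow> 'q machine \<Rightarrow> bool" where
  "is_machine A M \<longleftrightarrow>
     finite (states M) \<and> initial M \<in> states M \<and> terminal M \<in> states M \<and>
     finite (tape_alphabet M) \<and> A \<union> {Digit 0, Digit 1, Blank, Sep} \<subseteq> tape_alphabet M \<and>
     (\<forall>q \<in> states M - {terminal M}.
        \<forall>a \<in> tape_alphabet M. \<forall>b \<in> tape_alphabet M. \<forall>c \<in> tape_alphabet M.
          instr M q a b c \<in>
            states M \<times> tape_alphabet M \<times> {-1, 0, 1} \<times> {-1, 0, 1} \<times> {-1, 0, 1})"

type_synonym tape = "int \<Rightarrow> symbol"

definition word_tape :: "symbol word \<Rightarrow> tape" where
  "word_tape x = (\<lambda>n. if 0 \<le> n then x (nat n) else Blank)"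

definition list_tape :: "symbol list \<Rightarrow> tape" where
  "list_tape w = (\<lambda>n. if 0 \<le> n \<and> n < int (length w) then w ! nat n else Blank)"

record 'q config =
  state :: 'q
  tape3 :: tape
  head1 :: int
  head2 :: int
  head3 :: int

definition initial_config :: "'q machine \<Rightarrow> symbol list \<Rightarrow> 'q config" where
  "initial_config M w =
     \<lparr>state = initial M, tape3 = list_tape w, head1 = 0, head2 = 0, head3 = 0\<rparr>"

text \<open>Configurations in the terminal state do not change any more.\<close>

definition step :: "'q machine \<Rightarrow> symbol word \<Rightarrow> symbol word \<Rightarrow> 'q config \<Rightarrow> 'q config" where
  "step M x y c =
     (if state c = terminal M then c
      else (case instr M (state c) (word_tape x (head1 c)) (word_tape y (head2 c)) (tape3 c (head3 c))
            of (q, s, i, j, l) \<Rightarrow>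
              \<lparr>state = q, tape3 = (tape3 c)(head3 c := s),
               head1 = head1 c + i, head2 = head2 c + j, head3 = head3 c + l\<rparr>))"

definition terminates_with ::
    "'q machine \<Rightarrow> symbol word \<Rightarrow> symbol word \<Rightarrow> symbol list \<Rightarrow> tape \<Rightarrow> bool" where
  "terminates_with M x y w T \<longleftrightarrow>
     (\<exists>t. let c = (step M x y ^^ t) (initial_config M w)
          in state c = terminal M \<and> tape3 c = T)"

section \<open>Weak computability\<close>

definition weakly_computes ::
    "'q machine \<Rightarrow> symbol word set \<Rightarrow> (symbol word \<Rightarrow> symbol word \<Rightarrow> symbol word) \<Rightarrow> bool" where
  "weakly_computes M X F \<longleftrightarrow>
     (\<forall>x\<in>X. \<forall>y\<in>X. \<exists>h\<ge>1. \<forall>m.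
        terminates_with M x y (binary m @ [Sep] @ binary h) (list_tape [F x y m]))"

text \<open>
  Taking states from \<^typ>\<open>nat\<close> is no restriction, as there are only finitely many.
\<close>

definition weakly_computable ::
    "symbol set \<Rightarrow> symbol word set \<Rightarrow> (symbol word \<Rightarrow> symbol word \<Rightarrow> symbol word) \<Rightarrow> bool" where
  "weakly_computable A X F \<longleftrightarrow>
     is_encoding A X \<and> is_operation X F \<and>
     (\<exists>M :: nat machine. is_machine A M \<and> weakly_computes M X F)"

end

theory Submission
  imports Defs "HOL-Library.Countable"
begin

text \<open>
  Let \<open>z\<close> be the product of the decimals \<open>d\<close> and \<open>e\<close>. The number \<open>h\<close> may carry any finite amount of
  information about \<open>(d, e)\<close>, and that is exactly what a machine cannot find out by itself: whether
  \<open>z\<close> has a finite expansion. So \<open>h\<close> is a table, written in its binary digits, which contains an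
  initial piece of the code word of \<open>z\<close>, long enough to include the sign, the order and the first
  digit, followed by one further piece of advice.

  If the digits of \<open>z\<close> are eventually \<open>0\<close>, the piece includes all nonzero digits, and the
  advice is that all later symbols are \<open>0\<close>. Computing with the digits of the
  factors could fail here, as for \<open>0.333\<dots>\<close> times \<open>3\<close>, where no finite number of digits decides
  between \<open>0.999\<dots>\<close> and \<open>1\<close>.

  If infinitely many digits of \<open>z\<close> are nonzero, the machine multiplies. With \<open>D\<close>, \<open>E\<close> the digits of the
  factors from the leading one on, the sum of the first \<open>n + 1\<close> columns of the long multiplication is
  an integer \<open>S\<close> with \<open>S \<le> product * 10^n \<le> S + 9n + 19\<close> (\<open>column_sum_bounds\<close>). The digit of \<open>S\<close> in
  column \<open>p\<close> can differ from the true one only if adding less than \<open>10^(n div 2 + 2)\<close> to \<open>S\<close> sends a carry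
  through all the columns between \<open>p\<close> and roughly \<open>n / 2\<close>. A digit other than \<open>9\<close> in between stops the carry
  (\<open>settled_correct\<close>); and for large \<open>n\<close> there is one, since otherwise the true digits after
  column \<open>p\<close> would be all \<open>9\<close> or all \<open>0\<close> on longer and longer stretches (\<open>eventually_settled\<close>). The advice
  in \<open>h\<close> is in this case the offset between the places of \<open>z\<close> and the columns.

  The machine needs little bookkeeping because the two input heads do it. On the blank cells left of
  the inputs they are counters, which is how \<open>m\<close> is brought from binary to unary. On the digits they
  walk along an antidiagonal: as one head retreats from digit \<open>n\<close> to digit \<open>0\<close>, the other advances from digit
  \<open>0\<close> to digit \<open>n\<close>, which visits the factors of column \<open>n\<close>; and the walk back measures the distance \<open>n / 2\<close>.

  That \<open>z\<close> is the real product of \<open>d\<close> and \<open>e\<close> comes from the bijection between decimals and real numbers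
  (\<open>real_value_inj\<close>, \<open>real_value_surj\<close>), under which a generating sequence is a sequence of
  finite decimals that converges to the value (\<open>generates_iff\<close>).
\<close>

section \<open>Digit streams and real numbers\<close>

definition stream_value :: "(nat \<Rightarrow> nat) \<Rightarrow> real" where
  "stream_value D = (\<Sum>i. real (D i) / 10 ^ i)"

definition digit_stream :: "(nat \<Rightarrow> nat) \<Rightarrow> bool" where
  "digit_stream D \<longleftrightarrow> (\<forall>i. D i \<le> 9) \<and> (\<forall>n. \<exists>i\<ge>n. D i \<noteq> 9)"

primrec prefix_value :: "(nat \<Rightarrow> nat) \<Rightarrow> nat \<Rightarrow> nat" where
  "prefix_value D 0 = D 0"
| "prefix_value D (Suc n) = 10 * prefix_value D n + D (Suc n)"

lemma digit_le: "digit_stream D \<Longrightarrow> D i \<le> 9"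
  by (simp add: digit_stream_def)

lemma prefix_value_mod: "digit_stream D \<Longrightarrow> prefix_value D n mod 10 = D n"
  using digit_le[of D n] by (cases n) auto

lemma prefix_value_sum: "real (prefix_value D n) / 10 ^ n = (\<Sum>i\<le>n. real (D i) / 10 ^ i)"
  by (induction n) (simp_all add: field_simps)

lemma stream_summable:
  assumes "digit_stream D"
  shows "summable (\<lambda>i. real (D i) / 10 ^ i)"
proof (rule summable_comparison_test)
  show "\<exists>N. \<forall>n\<ge>N. norm (real (D n) / 10 ^ n) \<le> 9 * (1 / 10) ^ n"
    using digit_le[OF assms] by (intro exI[of _ 0]) (auto simp: field_simps)
qed (intro summable_mult summable_geometric, simp)

lemma prefix_value_tendsto:
  assumes "digit_stream D"
  shows "(\<lambda>n. real (prefix_value D n) / 10 ^ n) \<longlonglongrightarrow> stream_value D"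
  using summable_LIMSEQ'[OF stream_summable[OF assms]]
  by (simp add: prefix_value_sum stream_value_def)

text \<open>
  The upper bounds \<open>(prefix_value D n + 1) / 10 ^ n\<close> decrease to the value, and they drop strictly at
  each digit other than \<open>9\<close>. As such digits recur, the second inequality is strict, so that the
  prefixes are floors and the digits can be recovered from the value.
\<close>
lemma prefix_value_bounds:
  assumes "digit_stream D"
  shows "real (prefix_value D n) \<le> stream_value D * 10 ^ n"
    and "stream_value D * 10 ^ n < real (prefix_value D n) + 1"
proof -
  let ?l = "\<lambda>n. real (prefix_value D n) / 10 ^ n"
  let ?u = "\<lambda>n. (real (prefix_value D n) + 1) / 10 ^ n"
  have "incseq ?l" by (rule incseq_SucI) (simp add: field_simps)
  then have "?l n \<le> stream_value D"
    by (rule incseq_le) (rule prefix_value_tendsto[OF assms])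
  then show "real (prefix_value D n) \<le> stream_value D * 10 ^ n" by (simp add: field_simps)
  have "?u (Suc n) \<le> ?u n" for n
  proof -
    have "real (D (Suc n)) \<le> 9" using digit_le[OF assms, of "Suc n"] by simp
    then show ?thesis by (simp add: field_simps)
  qed
  then have u: "decseq ?u" by (rule decseq_SucI)
  have "?u \<longlonglongrightarrow> stream_value D + 0"
    unfolding add_divide_distrib
    by (intro tendsto_add prefix_value_tendsto[OF assms] LIMSEQ_divide_realpow_zero) simp
  then have le: "stream_value D \<le> ?u n" for n
    using decseq_ge[OF u] by simp
  obtain i where i: "Suc n \<le> i" "D i \<noteq> 9" using assms unfolding digit_stream_def by blast
  obtain j where j: "i = Suc j" using i(1) by (cases i) auto
  have "real (D (Suc j)) < 9" using i(2) digit_le[OF assms, of i] unfolding j by simp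
  then have "?u (Suc j) < ?u j" by (simp add: field_simps)
  also have "?u j \<le> ?u n" using u by (rule decseqD) (use i(1) j in linarith)
  finally have "?u (Suc j) < ?u n" .
  with le[of "Suc j"] have "stream_value D < ?u n" by (rule le_less_trans)
  then show "stream_value D * 10 ^ n < real (prefix_value D n) + 1" by (simp add: field_simps)
qed

lemma nat_floor_eqI: "real n \<le> x \<Longrightarrow> x < real n + 1 \<Longrightarrow> nat \<lfloor>x\<rfloor> = n"
  using floor_unique[of "int n" x] by simp

lemma nat_floor_stream: "digit_stream D \<Longrightarrow> nat \<lfloor>stream_value D * 10 ^ n\<rfloor> = prefix_value D n"
  by (intro nat_floor_eqI prefix_value_bounds)

lemma stream_digit: "digit_stream D \<Longrightarrow> nat \<lfloor>stream_value D * 10 ^ n\<rfloor> mod 10 = D n"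
  by (simp add: nat_floor_stream prefix_value_mod)

lemma stream_value_bounds:
  assumes "digit_stream D"
  shows "0 \<le> stream_value D" "real (D 0) \<le> stream_value D" "stream_value D < 10"
proof -
  show *: "real (D 0) \<le> stream_value D" using prefix_value_bounds(1)[OF assms, of 0] by simp
  then show "0 \<le> stream_value D" by linarith
  show "stream_value D < 10"
    using prefix_value_bounds(2)[OF assms, of 0] digit_le[OF assms, of 0] by simp
qed

lemma nat_floor_div_power:
  fixes x :: real
  assumes "0 \<le> x" "i \<le> j"
  shows "nat \<lfloor>x * 10 ^ i\<rfloor> = nat \<lfloor>x * 10 ^ j\<rfloor> div 10 ^ (j - i)"
proof -
  have "(10::real) ^ j = 10 ^ i * 10 ^ (j - i)"
    using assms(2) by (simp add: power_add[symmetric])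
  then have "x * 10 ^ i = (x * 10 ^ j) / real_of_int (10 ^ (j - i))" by simp
  then have "\<lfloor>x * 10 ^ i\<rfloor> = \<lfloor>x * 10 ^ j\<rfloor> div 10 ^ (j - i)"
    by (simp only: floor_divide_real_eq_div[of "10 ^ (j - i)"] zero_le_power zero_le_numeral)
  then show ?thesis using assms by (simp add: nat_div_distrib nat_power_eq)
qed

text \<open>
  Here \<open>G r\<close> is the number formed by the digits up to place \<open>r\<close>. If the last \<open>t\<close> digits are nines, one more unit
  turns all of them into zeros and raises the rest by one.
\<close>
lemma trailing_nines:
  assumes "\<And>r. p \<le> r \<Longrightarrow> r < p + t \<Longrightarrow> G (Suc r) div 10 = G r \<and> G (Suc r) mod 10 = (9::nat)"
  shows "G (p + t) + 1 = 10 ^ t * (G p + 1)"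
  using assms
proof (induction t)
  case (Suc t)
  have "G (p + t) + 1 = 10 ^ t * (G p + 1)" using Suc by simp
  moreover have "G (Suc (p + t)) = 10 * G (p + t) + 9"
    using Suc.prems[of "p + t"] mult_div_mod_eq[of 10 "G (Suc (p + t))"] by simp
  ultimately show ?case by (simp add: algebra_simps)
qed simp

text \<open>
  The floors never produce a tail of nines: with nines from place \<open>n\<close> on, \<open>x * 10 ^ n\<close> would be as close as
  one likes to the integer after its own floor, from below.
\<close>
lemma real_has_digit_stream:
  fixes x :: real
  assumes "0 \<le> x" "x < 10"
  defines "D \<equiv> \<lambda>i. nat \<lfloor>x * 10 ^ i\<rfloor> mod 10"
  shows "digit_stream D" "stream_value D = x"
proof -
  define G where "G = (\<lambda>i. nat \<lfloor>x * 10 ^ i\<rfloor>)"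
  have G: "real (G i) \<le> x * 10 ^ i" "x * 10 ^ i < real (G i) + 1" for i
    using assms(1) by (simp_all add: G_def)
  have G_Suc: "G (Suc i) div 10 = G i" for i
    using nat_floor_div_power[OF assms(1), of i "Suc i"] by (simp add: G_def)
  have D_G: "D i = G i mod 10" for i by (simp add: D_def G_def)
  have "\<exists>i\<ge>n. D i \<noteq> 9" for n
  proof (rule ccontr)
    assume "\<not> (\<exists>i\<ge>n. D i \<noteq> 9)"
    then have "G (Suc r) mod 10 = 9" if "n \<le> r" for r using that D_G[of "Suc r"] by simp
    then have nines: "G (n + t) + 1 = 10 ^ t * (G n + 1)" for t
      by (intro trailing_nines conjI G_Suc)
    have ge: "real (G n) + 1 - 1 / 10 ^ t \<le> x * 10 ^ n" for t
    proof -
      have "real (G (n + t)) + 1 = 10 ^ t * (real (G n) + 1)"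
        using arg_cong[OF nines[of t], of real] by (simp add: algebra_simps)
      with G(1)[of "n + t"] show ?thesis by (simp add: field_simps power_add)
    qed
    have "(\<lambda>t. real (G n) + 1 - 1 / 10 ^ t) \<longlonglongrightarrow> real (G n) + 1 - 0"
      by (intro tendsto_diff tendsto_const LIMSEQ_divide_realpow_zero) simp
    then have "real (G n) + 1 - 0 \<le> x * 10 ^ n"
      by (rule LIMSEQ_le_const2) (use ge in blast)
    with G(2)[of n] show False by simp
  qed
  moreover have "D i \<le> 9" for i
  proof -
    have "D i < 10" by (simp add: D_def)
    then show ?thesis by simp
  qed
  ultimately show D: "digit_stream D" unfolding digit_stream_def by blast
  have prefix: "prefix_value D n = G n" for n
  proof (induction n)
    case 0
    have "G 0 < 10" using G(1)[of 0] assms(2) by simp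
    then show ?case by (simp add: D_def G_def)
  next
    case (Suc n)
    have "D (Suc n) = G (Suc n) mod 10" by (simp add: D_def G_def)
    with Suc G_Suc[of n] mult_div_mod_eq[of 10 "G (Suc n)"] show ?case by simp
  qed
  have "(\<lambda>n. x - 1 / 10 ^ n) \<longlonglongrightarrow> x - 0"
    by (intro tendsto_diff tendsto_const LIMSEQ_divide_realpow_zero) simp
  then have lower: "(\<lambda>n. x - 1 / 10 ^ n) \<longlonglongrightarrow> x" by simp
  have "(\<lambda>n. real (prefix_value D n) / 10 ^ n) \<longlonglongrightarrow> x"
  proof (rule real_tendsto_sandwich[OF _ _ lower tendsto_const]; intro always_eventually allI)
    fix n
    show "x - 1 / 10 ^ n \<le> real (prefix_value D n) / 10 ^ n"
    proof -
      have "x \<le> (real (G n) + 1) / 10 ^ n" using G(2)[of n] by (simp add: pos_le_divide_eq)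
      then show ?thesis by (simp add: prefix add_divide_distrib)
    qed
    show "real (prefix_value D n) / 10 ^ n \<le> x"
      using G(1)[of n] by (simp add: prefix field_simps)
  qed
  then show "stream_value D = x"
    using prefix_value_tendsto[OF D] LIMSEQ_unique by blast
qed

section \<open>Decimals and real numbers\<close>

text \<open>
  Digits are counted from the leading one on, which is the order in which they are written in the code word.
\<close>
definition leading_digit :: "decimal \<Rightarrow> nat \<Rightarrow> nat" where
  "leading_digit d i = dec_digit d (int (dec_order d) - int i)"

definition magnitude :: "decimal \<Rightarrow> real" where
  "magnitude d = 10 ^ dec_order d * stream_value (leading_digit d)"

definition real_value :: "decimal \<Rightarrow> real" where
  "real_value d = (if dec_neg d then -1 else 1) * magnitude d"

lemma decimal_is_decimal: "is_decimal (dec_neg d) (dec_order d) (dec_digit d)"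
  using Rep_decimal[of d] by (simp add: dec_neg_def dec_order_def dec_digit_def split: prod.splits)

lemma decimal_eqI:
  assumes "dec_neg d = dec_neg e" "dec_order d = dec_order e" "dec_digit d = dec_digit e"
  shows "d = e"
proof -
  have "Rep_decimal d = Rep_decimal e"
    using assms by (intro prod_eqI) (simp_all add: dec_neg_def dec_order_def dec_digit_def)
  then show ?thesis by (simp add: Rep_decimal_inject)
qed

lemma leading_digit_stream: "digit_stream (leading_digit d)"
proof -
  have "leading_digit d i \<le> 9" for i
    using decimal_is_decimal[of d] by (simp add: is_decimal_def leading_digit_def)
  moreover have "\<exists>i\<ge>n. leading_digit d i \<noteq> 9" for n
  proof -
    have "\<not> (\<forall>m\<le>int (dec_order d) - int n. dec_digit d m = 9)"
    proof
      assume "\<forall>m\<le>int (dec_order d) - int n. dec_digit d m = 9"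
      moreover have "int (dec_order d) - int n \<le> int (dec_order d)" by simp
      ultimately show False using decimal_is_decimal[of d] unfolding is_decimal_def by blast
    qed
    then obtain m where m: "m \<le> int (dec_order d) - int n" "dec_digit d m \<noteq> 9" by blast
    define i where "i = nat (int (dec_order d) - m)"
    have "n \<le> i" "int (dec_order d) - int i = m" using m(1) by (simp_all add: i_def)
    then show ?thesis using m(2) by (auto simp: leading_digit_def)
  qed
  ultimately show ?thesis by (simp add: digit_stream_def)
qed

lemma leading_digit_0: "leading_digit d 0 = 0 \<Longrightarrow> dec_order d = 0"
  using decimal_is_decimal[of d] by (simp add: is_decimal_def leading_digit_def)

lemma digit_from_leading:
  "dec_digit d n = (if n \<le> int (dec_order d) then leading_digit d (nat (int (dec_order d) - n)) else 0)"
  using decimal_is_decimal[of d] by (simp add: is_decimal_def leading_digit_def)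

lemma magnitude_nonneg: "0 \<le> magnitude d"
  unfolding magnitude_def using stream_value_bounds(1)[OF leading_digit_stream] by simp

lemma magnitude_less: "magnitude d < 10 ^ Suc (dec_order d)"
  unfolding magnitude_def using stream_value_bounds(3)[OF leading_digit_stream, of d] by simp

lemma magnitude_ge: "0 < dec_order d \<Longrightarrow> 10 ^ dec_order d \<le> magnitude d"
proof -
  assume "0 < dec_order d"
  then have "1 \<le> leading_digit d 0" using leading_digit_0[of d] by (cases "leading_digit d 0") auto
  then have "1 \<le> stream_value (leading_digit d)"
    using stream_value_bounds(2)[OF leading_digit_stream, of d] by linarith
  then show ?thesis by (simp add: magnitude_def)
qed

text \<open>
  A positive order \<open>k\<close> is determined by \<open>10 ^ k \<le> magnitude < 10 ^ (k + 1)\<close>, and then the digits are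
  determined as floors.
\<close>
lemma magnitude_eq_imp:
  assumes "magnitude d = magnitude e"
  shows "dec_order d = dec_order e" "dec_digit d = dec_digit e"
proof -
  have le: "dec_order u \<le> dec_order v" if "magnitude u = magnitude v" for u v
  proof (rule ccontr)
    assume "\<not> dec_order u \<le> dec_order v"
    then have "(10::real) ^ Suc (dec_order v) \<le> 10 ^ dec_order u"
      by (intro power_increasing) auto
    also have "\<dots> \<le> magnitude u" using \<open>\<not> dec_order u \<le> dec_order v\<close> by (intro magnitude_ge) simp
    finally have "10 ^ Suc (dec_order v) \<le> magnitude v" unfolding that .
    with magnitude_less[of v] show False by linarith
  qed
  show order: "dec_order d = dec_order e" using le[OF assms] le[OF assms[symmetric]] by (rule le_antisym)
  then have "stream_value (leading_digit d) = stream_value (leading_digit e)"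
    using assms by (simp add: magnitude_def)
  then have "leading_digit d i = leading_digit e i" for i
    by (subst (1 2) stream_digit[OF leading_digit_stream, symmetric]) simp
  then have "leading_digit d = leading_digit e" by (rule ext)
  then show "dec_digit d = dec_digit e"
    by (intro ext) (simp add: digit_from_leading order)
qed

text \<open>
  For a nonzero value the sign can be read off; and condition (iii) on decimals leaves only one
  zero.
\<close>
lemma real_value_inj:
  assumes "real_value d = real_value e"
  shows "d = e"
proof -
  have abs: "\<bar>real_value u\<bar> = magnitude u" for u
    using magnitude_nonneg[of u] by (simp add: real_value_def)
  have mag: "magnitude d = magnitude e" using abs[of d] abs[of e] assms by simp
  note od = magnitude_eq_imp[OF mag]
  have zero: "\<not> dec_neg u" if "magnitude u = 0" for u
  proof -
    have "(0::real) < 10 ^ dec_order u" by simp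
    then have "\<not> 10 ^ dec_order u \<le> magnitude u" unfolding that by (simp only: not_le)
    then have "dec_order u = 0" using magnitude_ge[of u] by blast
    moreover have "leading_digit u i = 0" for i
      using stream_digit[OF leading_digit_stream[of u], of i] that by (simp add: magnitude_def)
    ultimately have "dec_digit u n = 0" for n by (simp add: digit_from_leading)
    then show ?thesis using decimal_is_decimal[of u] \<open>dec_order u = 0\<close> by (simp add: is_decimal_def)
  qed
  have "dec_neg d = dec_neg e"
  proof (cases "magnitude d = 0")
    case True
    then show ?thesis using zero[of d] zero[of e] mag by simp
  next
    case False
    then show ?thesis using assms mag by (auto simp: real_value_def split: if_splits)
  qed
  then show ?thesis using od by (rule decimal_eqI)
qed

lemma real_value_surj: "\<exists>d. real_value d = v"
proof -
  obtain N where "\<bar>v\<bar> < 10 ^ N" using real_arch_pow[of 10 "\<bar>v\<bar>"] by auto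
  also have "(10::real) ^ N \<le> 10 ^ Suc N" by simp
  finally have ex: "\<bar>v\<bar> < 10 ^ Suc N" .
  \<comment> \<open>the order is one less than the number of places in front of the point, of which there is at least one\<close>
  define P where "P = (\<lambda>k. \<bar>v\<bar> < 10 ^ Suc k)"
  define k where "k = (LEAST k. P k)"
  have "P N" using ex by (simp only: P_def)
  then have "P k" unfolding k_def by (rule LeastI)
  then have k: "\<bar>v\<bar> < 10 ^ Suc k" by (simp only: P_def)
  have k_least: "10 ^ k \<le> \<bar>v\<bar>" if nonzero: "k \<noteq> 0"
  proof -
    obtain j where j: "k = Suc j" using not0_implies_Suc[OF nonzero] by blast
    have "j < k" by (simp add: j)
    then have "\<not> P j" unfolding k_def by (rule not_less_Least)
    then show ?thesis by (simp only: P_def j not_less)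
  qed
  define x where "x = \<bar>v\<bar> / 10 ^ k"
  have x: "0 \<le> x" "x < 10" using k by (simp_all add: x_def divide_less_eq)
  define F where "F = (\<lambda>i. nat \<lfloor>x * 10 ^ i\<rfloor> mod 10)"
  have F: "digit_stream F" "stream_value F = x"
    unfolding F_def using x by (rule real_has_digit_stream)+
  define g where "g = (\<lambda>n. if n \<le> int k then F (nat (int k - n)) else 0)"
  have g: "g (int k - int i) = F i" for i by (simp add: g_def)
  have "is_decimal (v < 0) k g"
    unfolding is_decimal_def
  proof (intro conjI allI impI notI)
    fix n show "g n \<in> {0..9}" using digit_le[OF F(1)] by (simp add: g_def)
  next
    fix n assume "int k < n" then show "g n = 0" by (simp add: g_def)
  next
    assume "g (int k) = 0"
    then have "F 0 = 0" using g[of 0] by simp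
    then have "x < 1" using prefix_value_bounds(2)[OF F(1), of 0] F(2) by simp
    then have "\<bar>v\<bar> < 10 ^ k" by (simp add: x_def divide_less_eq)
    with k_least show "k = 0" by linarith
  next
    assume "\<exists>n\<le>int k. \<forall>m\<le>n. g m = 9"
    then obtain n where n: "n \<le> int k" "\<And>m. m \<le> n \<Longrightarrow> g m = 9" by blast
    obtain i where i: "i \<ge> nat (int k - n)" "F i \<noteq> 9" using F(1) unfolding digit_stream_def by blast
    have "int k - int i \<le> n" using i(1) n(1) by linarith
    then show False using n(2) g[of i] i(2) by simp
  next
    assume a: "v < 0 \<and> k = 0 \<and> (\<forall>n\<le>0. g n = 0)"
    then have "F i = 0" for i using g[of i] by simp
    then have "F = (\<lambda>_. 0)" by (intro ext)
    then have "x = 0" using F(2) by (simp add: stream_value_def)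
    then show False using a by (simp add: x_def)
  qed
  then have Rep: "Rep_decimal (Abs_decimal (v < 0, k, g)) = (v < 0, k, g)"
    by (intro Abs_decimal_inverse) simp
  define d where "d = Abs_decimal (v < 0, k, g)"
  have d: "dec_neg d \<longleftrightarrow> v < 0" "dec_order d = k" "dec_digit d = g"
    by (simp_all add: dec_neg_def dec_order_def dec_digit_def d_def Rep)
  have "leading_digit d = F" by (simp add: fun_eq_iff leading_digit_def d g)
  then have "real_value d = v" by (simp add: real_value_def magnitude_def d F(2) x_def)
  then show ?thesis ..
qed

lemma of_rat_powi: "real_of_rat (10 powi n) = 10 powi n"
  by (simp add: power_int_def of_rat_power of_rat_divide)

lemma truncation_leading:
  "real_of_rat (truncation d m) = (if dec_neg d then -1 else 1) * 10 ^ dec_order d *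
     (\<Sum>i\<le>dec_order d + m. real (leading_digit d i) / 10 ^ i)"
proof -
  let ?k = "dec_order d"
  have "(\<Sum>n\<in>{- int m..int ?k}. rat_of_nat (dec_digit d n) * 10 powi n)
      = (\<Sum>i\<le>?k + m. rat_of_nat (leading_digit d i) * 10 powi (int ?k - int i))"
    by (rule sum.reindex_bij_witness[of _ "\<lambda>i. int ?k - int i" "\<lambda>n. nat (int ?k - n)"])
       (auto simp: leading_digit_def)
  then have "real_of_rat (\<Sum>n\<in>{- int m..int ?k}. rat_of_nat (dec_digit d n) * 10 powi n)
      = (\<Sum>i\<le>?k + m. real (leading_digit d i) * 10 powi (int ?k - int i))"
    by (simp add: of_rat_sum of_rat_mult of_rat_powi)
  also have "\<dots> = (\<Sum>i\<le>?k + m. 10 ^ ?k * (real (leading_digit d i) / 10 ^ i))"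
    by (intro sum.cong refl) (simp add: power_int_diff)
  also have "\<dots> = 10 ^ ?k * (\<Sum>i\<le>?k + m. real (leading_digit d i) / 10 ^ i)"
    by (rule sum_distrib_left[symmetric])
  finally show ?thesis
    unfolding truncation_def of_rat_mult by (simp only: mult.assoc) simp
qed

lemma truncation_tendsto: "(\<lambda>m. real_of_rat (truncation d m)) \<longlonglongrightarrow> real_value d"
proof -
  have "(\<lambda>n. \<Sum>i\<le>n. real (leading_digit d i) / 10 ^ i) \<longlonglongrightarrow> stream_value (leading_digit d)"
    unfolding stream_value_def by (rule summable_LIMSEQ'[OF stream_summable[OF leading_digit_stream]])
  then have "(\<lambda>m. \<Sum>i\<le>m + dec_order d. real (leading_digit d i) / 10 ^ i)
      \<longlonglongrightarrow> stream_value (leading_digit d)"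
    by (rule LIMSEQ_ignore_initial_segment)
  then have "(\<lambda>m. (if dec_neg d then -1 else 1) * 10 ^ dec_order d *
      (\<Sum>i\<le>m + dec_order d. real (leading_digit d i) / 10 ^ i))
      \<longlonglongrightarrow> (if dec_neg d then -1 else 1) * 10 ^ dec_order d * stream_value (leading_digit d)"
    by (intro tendsto_mult tendsto_const)
  then show ?thesis
    by (simp only: truncation_leading real_value_def magnitude_def add.commute[of "dec_order d"] mult.assoc)
qed

lemma truncation_in_Q_D: "truncation d m \<in> Q_D"
proof -
  let ?k = "dec_order d"
  have "(\<Sum>n\<in>{- int m..int ?k}. rat_of_nat (dec_digit d n) * 10 powi n)
      = of_int (\<Sum>n\<in>{- int m..int ?k}. int (dec_digit d n) * 10 ^ nat (n + int m)) / 10 ^ m"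
    unfolding of_int_sum sum_divide_distrib
  proof (intro sum.cong refl)
    fix n assume "n \<in> {- int m..int ?k}"
    then have "(10::rat) powi n = 10 ^ nat (n + int m) / 10 ^ m"
      using power_int_diff[of "10::rat" "n + int m" "int m"] by (simp add: power_int_def)
    then show "rat_of_nat (dec_digit d n) * 10 powi n
        = of_int (int (dec_digit d n) * 10 ^ nat (n + int m)) / 10 ^ m" by simp
  qed
  then obtain a where "(\<Sum>n\<in>{- int m..int ?k}. rat_of_nat (dec_digit d n) * 10 powi n) = of_int a / 10 ^ m"
    by blast
  then have "truncation d m = of_int (if dec_neg d then - a else a) / 10 ^ m"
    by (simp add: truncation_def)
  then show ?thesis unfolding Q_D_def by blast
qed

lemma Q_D_mult: "p \<in> Q_D \<Longrightarrow> q \<in> Q_D \<Longrightarrow> p * q \<in> Q_D"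
proof -
  assume "p \<in> Q_D" "q \<in> Q_D"
  then obtain a m b n where "p = of_int a / 10 ^ m" "q = of_int b / 10 ^ n" unfolding Q_D_def by blast
  then have "p * q = of_int (a * b) / 10 ^ (m + n)" by (simp add: power_add)
  then show ?thesis unfolding Q_D_def by blast
qed

lemma abs_of_rat_less: "\<bar>p - q\<bar> < 1 / of_nat k \<longleftrightarrow> \<bar>real_of_rat p - real_of_rat q\<bar> < 1 / real k"
proof -
  have "\<bar>p - q\<bar> < 1 / of_nat k \<longleftrightarrow> real_of_rat \<bar>p - q\<bar> < real_of_rat (1 / of_nat k)"
    by (simp only: of_rat_less)
  then show ?thesis by (simp only: abs_of_rat[symmetric] of_rat_diff of_rat_divide of_rat_1 of_rat_of_nat_eq)
qed

lemma close_imp_tendsto: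
  fixes f g :: "nat \<Rightarrow> real"
  assumes "g \<longlonglongrightarrow> v" "\<forall>k\<ge>1. \<exists>n0\<ge>1. \<forall>n\<ge>n0. \<bar>g n - f n\<bar> < 1 / real k"
  shows "f \<longlonglongrightarrow> v"
proof -
  have "(\<lambda>n. g n - f n) \<longlonglongrightarrow> 0"
  proof (rule LIMSEQ_I)
    fix r :: real assume "0 < r"
    then obtain k where k: "0 < k" "1 / real k < r" using ex_inverse_of_nat_less[of r] by (auto simp: inverse_eq_divide)
    then have "1 \<le> k" by simp
    then obtain n0 where n0: "\<And>n. n0 \<le> n \<Longrightarrow> \<bar>g n - f n\<bar> < 1 / real k" using assms(2) by blast
    have "norm (g n - f n - 0) < r" if "n0 \<le> n" for n
      using less_trans[OF n0[OF that] k(2)] by simp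
    then show "\<exists>no. \<forall>n\<ge>no. norm (g n - f n - 0) < r" by blast
  qed
  from tendsto_diff[OF assms(1) this] show ?thesis by simp
qed

lemma tendsto_imp_close:
  fixes f g :: "nat \<Rightarrow> real"
  assumes "f \<longlonglongrightarrow> v" "g \<longlonglongrightarrow> v" "1 \<le> k"
  shows "\<exists>n0\<ge>1. \<forall>m\<ge>n0. \<forall>n\<ge>n0. \<bar>g m - f n\<bar> < 1 / real k"
proof -
  have pos: "0 < 1 / (2 * real k)" using assms(3) by simp
  obtain n1 where n1: "\<And>n. n1 \<le> n \<Longrightarrow> norm (f n - v) < 1 / (2 * real k)"
    using LIMSEQ_D[OF assms(1) pos] by blast
  obtain n2 where n2: "\<And>n. n2 \<le> n \<Longrightarrow> norm (g n - v) < 1 / (2 * real k)"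
    using LIMSEQ_D[OF assms(2) pos] by blast
  have half: "1 / (2 * real k) + 1 / (2 * real k) = 1 / real k" by (simp add: field_simps)
  show ?thesis
  proof (intro exI[of _ "max 1 (max n1 n2)"] conjI allI impI)
    fix m n assume "max 1 (max n1 n2) \<le> m" "max 1 (max n1 n2) \<le> n"
    then have "n2 \<le> m" "n1 \<le> n" by simp_all
    then show "\<bar>g m - f n\<bar> < 1 / real k" 
      using n2[of m] n1[of n] half unfolding real_norm_def by linarith
  qed simp
qed

text \<open>
  Reduces the two \<open>1 / k\<close> conditions on generating sequences to convergence in the reals, where the limit
  laws give products of sequences at once.
\<close>
lemma generates_iff:
  "generates a d \<longleftrightarrow> (\<forall>n\<ge>1. a n \<in> Q_D) \<and> (\<lambda>n. real_of_rat (a n)) \<longlonglongrightarrow> real_value d"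
proof
  assume g: "generates a d"
  then have "(\<lambda>n. real_of_rat (a n)) \<longlonglongrightarrow> real_value d"
    unfolding generates_def abs_of_rat_less by (intro close_imp_tendsto[OF truncation_tendsto]) blast
  then show "(\<forall>n\<ge>1. a n \<in> Q_D) \<and> (\<lambda>n. real_of_rat (a n)) \<longlonglongrightarrow> real_value d"
    using g by (simp add: generates_def cauchy_Q_D_def)
next
  assume a: "(\<forall>n\<ge>1. a n \<in> Q_D) \<and> (\<lambda>n. real_of_rat (a n)) \<longlonglongrightarrow> real_value d"
  then have lim: "(\<lambda>n. real_of_rat (a n)) \<longlonglongrightarrow> real_value d" ..
  show "generates a d"
    unfolding generates_def cauchy_Q_D_def abs_of_rat_less
    using a tendsto_imp_close[OF lim lim] tendsto_imp_close[OF lim truncation_tendsto] by meson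
qed

lemma real_value_mult: "real_value (decimal_mult d e) = real_value d * real_value e"
proof -
  obtain z where z: "real_value z = real_value d * real_value e" using real_value_surj by blast
  have "decimal_mult d e = z"
    unfolding decimal_mult_def
  proof (rule the_equality)
    have "generates (truncation d) d" "generates (truncation e) e"
      by (simp_all add: generates_iff truncation_in_Q_D truncation_tendsto)
    moreover have "generates (\<lambda>n. truncation d n * truncation e n) z"
      by (simp add: generates_iff truncation_in_Q_D Q_D_mult of_rat_mult z tendsto_mult truncation_tendsto)
    ultimately show "\<exists>a b. generates a d \<and> generates b e \<and> generates (\<lambda>n. a n * b n) z" by blast
  next
    fix z' assume "\<exists>a b. generates a d \<and> generates b e \<and> generates (\<lambda>n. a n * b n) z'"
    then obtain a b where ab: "generates a d" "generates b e" "generates (\<lambda>n. a n * b n) z'" by blast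
    have "(\<lambda>n. real_of_rat (a n) * real_of_rat (b n)) \<longlonglongrightarrow> real_value d * real_value e"
      using ab(1,2) by (intro tendsto_mult) (simp_all add: generates_iff)
    moreover have "(\<lambda>n. real_of_rat (a n) * real_of_rat (b n)) \<longlonglongrightarrow> real_value z'"
      using ab(3) by (simp add: generates_iff of_rat_mult)
    ultimately have "real_value z' = real_value z" using z LIMSEQ_unique by metis
    then show "z' = z" by (rule real_value_inj)
  qed
  with z show ?thesis by simp
qed

lemma magnitude_mult: "magnitude (decimal_mult d e) = magnitude d * magnitude e"
proof -
  have "magnitude u = \<bar>real_value u\<bar>" for u
    using magnitude_nonneg[of u] by (simp add: real_value_def)
  then show ?thesis by (simp add: real_value_mult abs_mult)
qed

section \<open>Long multiplication by columns\<close>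

text \<open>
  The result of long multiplication after its first \<open>n\<close> columns, carries included: column \<open>n\<close> holds the
  products of digits whose places add up to \<open>n\<close>.
\<close>
primrec column_sum :: "(nat \<Rightarrow> nat) \<Rightarrow> (nat \<Rightarrow> nat) \<Rightarrow> nat \<Rightarrow> nat" where
  "column_sum D E 0 = 0"
| "column_sum D E (Suc n) = 10 * column_sum D E n + (\<Sum>i\<le>n. D (n - i) * E i)"

text \<open>
  The columns after \<open>n\<close> are worth less than one unit of any column \<open>r \<le> n - 2 - n div 2\<close>, since
  \<open>9 n + 19 < 10 ^ (n div 2 + 2)\<close>. A digit other than \<open>9\<close> in such a column, to the right of column \<open>p\<close>,
  therefore keeps their carry away from \<open>p\<close>. The bound is halfway because a machine can halve a distance,
  whereas it would have to compute the logarithm of \<open>n\<close> for a sharp one.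
\<close>
definition digit_settled :: "(nat \<Rightarrow> nat) \<Rightarrow> (nat \<Rightarrow> nat) \<Rightarrow> nat \<Rightarrow> nat \<Rightarrow> bool" where
  "digit_settled D E p n \<longleftrightarrow> (\<exists>r>p. int r \<le> int n - 2 - int (n div 2) \<and>
     column_sum D E (Suc n) div 10 ^ (n - r) mod 10 \<noteq> 9)"

locale factors =
  fixes D E :: "nat \<Rightarrow> nat"
  assumes D: "digit_stream D" and E: "digit_stream E"
begin

definition product :: real where
  "product = stream_value D * stream_value E"

text \<open>
  Up to the scaling, the column sums are the partial sums of the Cauchy product of the two digit series.
\<close>
lemma column_sum_tendsto:
  "(\<lambda>n. real (column_sum D E (Suc n)) / 10 ^ n) \<longlonglongrightarrow> product"
proof -
  let ?c = "\<lambda>n. \<Sum>i\<le>n. D (n - i) * E i"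
  have "(\<lambda>n. \<Sum>i\<le>n. (real (E i) / 10 ^ i) * (real (D (n - i)) / 10 ^ (n - i)))
      sums (stream_value E * stream_value D)"
    unfolding stream_value_def
    by (rule Cauchy_product_sums) (use stream_summable[OF D] stream_summable[OF E] in simp_all)
  moreover have "(\<Sum>i\<le>n. (real (E i) / 10 ^ i) * (real (D (n - i)) / 10 ^ (n - i))) = real (?c n) / 10 ^ n" for n
  proof -
    have "(\<Sum>i\<le>n. (real (E i) / 10 ^ i) * (real (D (n - i)) / 10 ^ (n - i)))
        = (\<Sum>i\<le>n. real (D (n - i) * E i) / 10 ^ n)"
      by (intro sum.cong refl) (simp add: power_add[symmetric])
    then show ?thesis by (simp add: sum_divide_distrib)
  qed
  ultimately have "(\<lambda>n. real (?c n) / 10 ^ n) sums product"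
    by (simp add: product_def mult.commute)
  then have "(\<lambda>n. \<Sum>i\<le>n. real (?c i) / 10 ^ i) \<longlonglongrightarrow> product"
    by (simp only: sums_def_le)
  moreover have "(\<Sum>i\<le>n. real (?c i) / 10 ^ i) = real (column_sum D E (Suc n)) / 10 ^ n" for n
    by (induction n) (simp_all add: field_simps)
  ultimately show ?thesis by simp
qed

text \<open>
  The upper bounds, divided by \<open>10 ^ n\<close>, do not increase: the next column is at most \<open>81 (n + 2)\<close>, and
  \<open>9 (n + 1) + 19 + 81 (n + 2) = 10 (9 n + 19)\<close>.
\<close>
lemma column_sum_bounds:
  "real (column_sum D E (Suc n)) \<le> product * 10 ^ n"
  "product * 10 ^ n \<le> real (column_sum D E (Suc n)) + 9 * real n + 19"
proof -
  let ?s = "\<lambda>n. real (column_sum D E (Suc n))"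
  have "incseq (\<lambda>n. ?s n / 10 ^ n)" by (rule incseq_SucI) (simp add: field_simps sum_nonneg)
  then have "?s n / 10 ^ n \<le> product" by (rule incseq_le) (rule column_sum_tendsto)
  then show "?s n \<le> product * 10 ^ n" by (simp add: field_simps)
  let ?u = "\<lambda>n. (?s n + 9 * real n + 19) / 10 ^ n"
  have "?u (Suc n) \<le> ?u n" for n
  proof -
    have "(\<Sum>i\<le>Suc n. D (Suc n - i) * E i) \<le> (\<Sum>i\<le>Suc n. 9 * 9)"
      using digit_le[OF D] digit_le[OF E] by (intro sum_mono mult_le_mono)
    then have "(\<Sum>i\<le>Suc n. D (Suc n - i) * E i) \<le> 81 * (n + 2)" by simp
    then have "column_sum D E (Suc (Suc n)) \<le> 10 * column_sum D E (Suc n) + 81 * (n + 2)"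
      by (subst column_sum.simps(2)) (rule add_left_mono)
    then have "?s (Suc n) \<le> 10 * ?s n + 81 * (real n + 2)"
      using of_nat_mono[where 'a = real] by fastforce
    then have "?s (Suc n) + 9 * real (Suc n) + 19 \<le> 10 * (?s n + 9 * real n + 19)"
      by (simp del: column_sum.simps add: algebra_simps)
    then have "?u (Suc n) \<le> 10 * (?s n + 9 * real n + 19) / 10 ^ Suc n"
      by (rule divide_right_mono) simp
    also have "\<dots> = ?u n" by (simp del: column_sum.simps add: field_simps)
    finally show ?thesis .
  qed
  then have u: "decseq ?u" by (rule decseq_SucI)
  have "?s k / 10 ^ k \<le> ?u n" if "n \<le> k" for k
  proof -
    have "?s k / 10 ^ k \<le> ?u k" by (intro divide_right_mono) simp_all
    also have "\<dots> \<le> ?u n" using u that by (rule decseqD)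
    finally show ?thesis .
  qed
  then have "product \<le> ?u n"
    by (intro LIMSEQ_le_const2[OF column_sum_tendsto]) blast
  then show "product * 10 ^ n \<le> ?s n + 9 * real n + 19"
    by (simp del: column_sum.simps add: field_simps)
qed

lemma product_bounds: "0 \<le> product" "product < 100"
proof -
  note b = stream_value_bounds[OF D] stream_value_bounds[OF E]
  show "0 \<le> product" unfolding product_def using b by (intro mult_nonneg_nonneg)
  have "product < 10 * 10" unfolding product_def using b by (intro mult_strict_mono) auto
  then show "product < 100" by simp
qed

text \<open>
  The columns fit into \<open>n + 1\<close> digits, so the machine needs only one cell to the left of column \<open>0\<close>.
\<close>
lemma column_sum_less: "column_sum D E n < 10 ^ Suc n"
proof (cases n)
  case (Suc k)
  have "real (column_sum D E n) \<le> product * 10 ^ k"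
    unfolding Suc by (rule column_sum_bounds)
  also have "\<dots> < 100 * 10 ^ k" using product_bounds by simp
  also have "\<dots> = real (10 ^ Suc n)" by (simp add: Suc)
  finally show ?thesis by (simp only: of_nat_less_iff)
qed simp

text \<open>
  The number that the true digits of the product form up to column \<open>r\<close>.
\<close>
definition leading :: "nat \<Rightarrow> nat" where
  "leading r = nat \<lfloor>product * 10 ^ r\<rfloor>"

lemma leading_div: "r \<le> q \<Longrightarrow> leading r = leading q div 10 ^ (q - r)"
  unfolding leading_def using product_bounds(1) by (rule nat_floor_div_power)

text \<open>
  The carry that the later columns send into column \<open>r\<close> is \<open>0\<close> or \<open>1\<close>.
\<close>
lemma leading_cases:
  assumes "int r \<le> int n - 2 - int (n div 2)"
  shows "leading r = column_sum D E (Suc n) div 10 ^ (n - r) \<or>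
    leading r = Suc (column_sum D E (Suc n) div 10 ^ (n - r))"
proof -
  define s e where "s = column_sum D E (Suc n)" and "e = n - r"
  have r: "r \<le> n" "n div 2 + 2 \<le> e" using assms by (auto simp: e_def)
  have tail: "9 * n + 19 < 10 ^ e"
  proof -
    have "n \<le> 2 * (n div 2) + 1" by simp
    then have "9 * n \<le> 9 * (2 * (n div 2) + 1)" by (rule mult_le_mono2)
    also have "\<dots> = 18 * (n div 2) + 9" by simp
    finally have "9 * n + 19 \<le> 18 * (n div 2) + 28" by simp
    also have "\<dots> < 100 * (n div 2) + 100" by simp
    finally have "9 * n + 19 < 100 * (n div 2 + 1)" by simp
    also have "\<dots> \<le> 100 * 10 ^ (n div 2)"
    proof -
      have "j + 1 \<le> 10 ^ j" for j :: nat by (induction j) auto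
      then show ?thesis by (rule mult_le_mono2)
    qed
    also have "\<dots> = 10 ^ (n div 2 + 2)" by (simp add: power_add)
    also have "\<dots> \<le> 10 ^ e" using r by (intro power_increasing) auto
    finally show ?thesis .
  qed
  define y where "y = s div 10 ^ e"
  have s: "y * 10 ^ e \<le> s" "s < y * 10 ^ e + 10 ^ e"
    using div_mult_mod_eq[of s "10 ^ e"] mod_less_divisor[of "10 ^ e" s] unfolding y_def
    by (linarith, simp only: dividend_less_div_times zero_less_power zero_less_numeral add.commute)
  have split: "product * 10 ^ n = product * 10 ^ r * 10 ^ e"
    using r by (simp add: e_def power_add[symmetric])
  have "real y * 10 ^ e \<le> product * 10 ^ r * 10 ^ e"
  proof -
    have "real (y * 10 ^ e) \<le> real s" using s(1) by (rule of_nat_mono)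
    also have "real s \<le> product * 10 ^ r * 10 ^ e"
      using column_sum_bounds(1)[of n] by (simp only: split s_def)
    finally show ?thesis by simp
  qed
  then have lower: "real y \<le> product * 10 ^ r" by simp
  have "product * 10 ^ r * 10 ^ e < (real y + 2) * 10 ^ e"
  proof -
    have "s + (9 * n + 19) < y * 10 ^ e + 10 ^ e + 10 ^ e" using s(2) tail by linarith
    then have "real (s + (9 * n + 19)) < real (y * 10 ^ e + 10 ^ e + 10 ^ e)"
      by (simp only: of_nat_less_iff)
    then show ?thesis
      using column_sum_bounds(2)[of n] unfolding split s_def[symmetric]
      by (simp add: algebra_simps)
  qed
  then have upper: "product * 10 ^ r < real y + 2" by simp
  have "leading r = y \<or> leading r = Suc y"
  proof (cases "product * 10 ^ r < real y + 1")
    case True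
    then show ?thesis unfolding leading_def using lower nat_floor_eqI by blast
  next
    case False
    then have "nat \<lfloor>product * 10 ^ r\<rfloor> = Suc y" using upper by (intro nat_floor_eqI) auto
    then show ?thesis by (simp add: leading_def)
  qed
  then show ?thesis by (simp only: y_def s_def e_def)
qed

text \<open>
  A carry of at most \<open>1\<close> arrives at a digit other than \<open>9\<close> and goes no further.
\<close>
lemma settled_correct:
  assumes "digit_settled D E p n"
  shows "column_sum D E (Suc n) div 10 ^ (n - p) = leading p"
proof -
  define y where "y = (\<lambda>r. column_sum D E (Suc n) div 10 ^ (n - r))"
  obtain r where r: "p < r" "int r \<le> int n - 2 - int (n div 2)" "y r mod 10 \<noteq> 9"
    using assms unfolding digit_settled_def y_def by blast
  have "r \<le> n" using r(2) by linarith
  have y_p: "y p = y r div 10 ^ (r - p)"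
    using r(1) \<open>r \<le> n\<close> by (simp add: y_def div_mult2_eq[symmetric] power_add[symmetric])
  have "Suc (y r) div 10 ^ (r - p) = y r div 10 ^ (r - p)"
  proof -
    obtain t where t: "r - p = Suc t" using r(1) by (metis Suc_diff_Suc)
    have "Suc (y r) div 10 = y r div 10" using r(3) by (auto simp: div_Suc mod_Suc split: if_splits)
    then show ?thesis by (simp add: t div_mult2_eq)
  qed
  then have "leading r div 10 ^ (r - p) = y p"
    using leading_cases[OF r(2)] y_p unfolding y_def by metis
  then show ?thesis using leading_div[of p r] r(1) by (simp add: y_def)
qed

text \<open>
  If \<open>p\<close> is not settled at \<open>n\<close>, the computed digits are nines all the way from column \<open>p + 1\<close> to column \<open>q\<close>. The carry into
  column \<open>q\<close> then decides between two extremes: the true digits on this stretch are all \<open>9\<close> (carry \<open>0\<close>) or all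
  \<open>0\<close> (carry \<open>1\<close>). A stretch that contains both a true digit other than \<open>9\<close> and one other than \<open>0\<close> excludes both.
\<close>
lemma eventually_settled:
  assumes nines: "\<And>n. \<exists>i\<ge>n. leading i mod 10 \<noteq> 9" and zeros: "\<And>n. \<exists>i\<ge>n. leading i mod 10 \<noteq> 0"
  shows "\<exists>n. digit_settled D E p n"
proof (rule ccontr)
  assume unsettled: "\<nexists>n. digit_settled D E p n"
  obtain i where i: "p < i" "leading i mod 10 \<noteq> 9" using nines[of "Suc p"] unfolding Suc_le_eq by blast
  obtain j where j: "p < j" "leading j mod 10 \<noteq> 0" using zeros[of "Suc p"] unfolding Suc_le_eq by blast
  \<comment> \<open>the least even n for which the columns up to q may be inspected\<close>
  define q n where "q = max i j" and "n = 2 * q + 4"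
  have q: "int q = int n - 2 - int (n div 2)" "q \<le> n" by (auto simp: n_def)
  define y where "y = (\<lambda>r. column_sum D E (Suc n) div 10 ^ (n - r))"
  have y_div: "y r = y q div 10 ^ (q - r)" if "r \<le> q" for r
    using that q(2) by (simp add: y_def div_mult2_eq[symmetric] power_add[symmetric])
  have y9: "y r mod 10 = 9" if "p < r" "r \<le> q" for r
    using unsettled that q unfolding digit_settled_def y_def by fastforce
  have "leading q = y q \<or> leading q = Suc (y q)"
    unfolding y_def by (rule leading_cases) (use q in simp)
  then show False
  proof
    assume "leading q = y q"
    then have "leading i = y i" using leading_div[of i q] y_div[of i] by (simp add: q_def)
    with i y9[of i] show False by (simp add: q_def)
  next
    assume *: "leading q = Suc (y q)"
    have "y (p + (q - p)) + 1 = 10 ^ (q - p) * (y p + 1)"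
    proof (rule trailing_nines)
      fix r assume r: "p \<le> r" "r < p + (q - p)"
      have "y (Suc r) div 10 = y r"
      proof -
        have "q - r = Suc (q - Suc r)" using r by simp
        then have "y r = y q div (10 ^ (q - Suc r) * 10)"
          using y_div[of r] r by (simp add: mult.commute)
        also have "\<dots> = y (Suc r) div 10"
          using y_div[of "Suc r"] r by (simp only: div_mult2_eq)
        finally show ?thesis by simp
      qed
      then show "y (Suc r) div 10 = y r \<and> y (Suc r) mod 10 = 9" using y9[of "Suc r"] r by simp
    qed
    then have "leading q = 10 ^ (q - p) * (y p + 1)" using * j(1) by (simp add: q_def)
    also have "10 ^ (q - p) = (10 ^ (j - p) * 10 ^ (q - j) :: nat)"
      using j(1) by (simp add: q_def power_add[symmetric])
    finally have "leading j = 10 ^ (j - p) * (y p + 1)"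
      using leading_div[of j q] by (simp add: q_def)
    moreover obtain t where "j - p = Suc t" using j(1) by (metis Suc_diff_Suc)
    ultimately have "leading j mod 10 = 0" by simp
    with j(2) show False by simp
  qed
qed

end

section \<open>The machine\<close>

text \<open>
  The phases in the order of their use: the binary digits of \<open>m\<close> are turned into a head position, the table
  \<open>h\<close> is consulted, the columns are laid out and the heads brought to the first digits; then each column
  is opened, summed up, and followed by the test for a settled digit; finally the work tape is
  cleared. Parameters are the finite memory: the length of the current table entry, the amount still to be
  added, the symbol to be output.
\<close>
datatype phase =
    FindSep | ReadBit | Double | Double' | CopyBack | SkipInput | Table nat
  | Fill | Unfill | Seek1 | Seek2
  | Open | Multiply | Add nat | Return
  | Sweep | SweepStay | SweepLeft | Scan | Found | Resume
  | Output symbol | Erase symbol | Write symbol | Halt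

instance symbol :: countable by countable_datatype
instance phase :: countable by countable_datatype

fun digit_of :: "symbol \<Rightarrow> nat" where
  "digit_of (Digit n) = n"
| "digit_of (Aux n) = n"
| "digit_of _ = 0"

fun set_digit :: "symbol \<Rightarrow> nat \<Rightarrow> symbol" where
  "set_digit (Aux _) n = Aux n"
| "set_digit _ n = Digit n"

text \<open>
  Cells of columns that have not been opened yet. A cell of an open column holds a \<^const>\<open>Digit\<close>, or an
  \<^const>\<open>Aux\<close> symbol in the column whose digit is wanted, so that this column can be recognized; before
  it is opened it holds \<^const>\<open>Sep\<close>. \<^const>\<open>Sep\<close> also separates the two input numbers, which stops the scan to the left. Closed columns before
  the marked one hold \<^const>\<open>Minus\<close>, so that no blank cell interrupts the written region.
\<close>
definition fresh :: "symbol \<Rightarrow> bool" where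
  "fresh c \<longleftrightarrow> c \<in> {Minus, Sep, Blank}"

text \<open>
  Table entries \<open>0, \<dots>, 11\<close> stand for the symbols of code words; \<open>12\<close> and \<open>13\<close> are the two kinds of advice.
\<close>
definition table_symbol :: "nat \<Rightarrow> symbol" where
  "table_symbol i = (if i \<le> 9 then Digit i else if i = 10 then Minus else Sep)"

fun instruction :: "phase \<Rightarrow> symbol \<Rightarrow> symbol \<Rightarrow> symbol \<Rightarrow> phase \<times> symbol \<times> int \<times> int \<times> int" where
  "instruction FindSep a b c = (if c = Sep then (ReadBit, c, 0, 0, -1) else (FindSep, c, 0, 0, 1))"
  \<comment> \<open>minus the position of head 1 is the number read so far; doubling it uses head 2\<close>
| "instruction ReadBit a b c = (if c = Blank then (SkipInput, c, 0, 0, 1) else (Double, c, 0, 0, 0))"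
| "instruction Double a b c = (if a = Blank then (Double', c, 1, -1, 0) else (CopyBack, c, 0, 0, 0))"
| "instruction Double' a b c = (Double, c, 0, -1, 0)"
| "instruction CopyBack a b c =
     (if b = Blank then (CopyBack, c, -1, 1, 0)
      else (ReadBit, c, if c = Digit 1 then -1 else 0, 0, -1))"
| "instruction SkipInput a b c = (if c = Sep then (Table 0, c, 0, 0, 1) else (SkipInput, c, 0, 0, 1))"
  \<comment> \<open>\<open>i\<close> counts the zeros of the current entry; head 1 at cell 0 means that the entry is the wanted one;
      entry 12 increases the count on head 1, entry 13 promises zeros from here on\<close>
| "instruction (Table i) a b c =
     (if c = Digit 0 then (Table (min 13 (i + 1)), c, 0, 0, 1)
      else if c = Blank then (Fill, Digit 0, 0, 0, 1)
      else if i = 13 then (Output (Digit 0), c, 0, 0, 0)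
      else if i = 12 then (Table 0, c, -1, 0, 1)
      else if a = Blank then (Table 0, c, 1, 0, 1)
      else (Output (table_symbol i), c, 0, 0, 0))"
| "instruction Fill a b c = (if a = Blank then (Fill, Minus, 1, 0, 1) else (Unfill, Sep, 0, 0, -1))"
| "instruction Unfill a b c = (if c = Minus then (Unfill, c, 0, 0, -1) else (Seek1, c, 0, 0, 1))"
| "instruction Seek1 a b c = (if a = Sep then (Seek2, c, 1, 0, 0) else (Seek1, c, 1, 0, 0))"
| "instruction Seek2 a b c = (if b = Sep then (Open, c, 0, 1, 0) else (Seek2, c, 0, 1, 0))"
| "instruction Open a b c = (Multiply, if c = Sep then Aux 0 else Digit 0, 0, 0, 0)"
  \<comment> \<open>head 1 at the separator means that the antidiagonal has been walked through\<close>
| "instruction Multiply a b c =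
     (if a = Sep then (Sweep, c, 1, -1, -1) else (Add (digit_of a * digit_of b), c, 0, 0, 0))"
  \<comment> \<open>add \<open>v\<close> to the digit and carry to the left; then look for the end of the open columns\<close>
| "instruction (Add v) a b c =
     (if v = 0 then (Return, c, 0, 0, 0)
      else (Add ((digit_of c + v) div 10), set_digit c ((digit_of c + v) mod 10), 0, 0, -1))"
| "instruction Return a b c = (if fresh c then (Multiply, c, -1, 1, -1) else (Return, c, 0, 0, 1))"
  \<comment> \<open>walk back along the antidiagonal, with head 3 moving left twice and then at every other step\<close>
| "instruction Sweep a b c = (SweepStay, c, 1, -1, -1)"
| "instruction SweepStay a b c = (if b = Sep then (Scan, c, 0, 0, 0) else (SweepLeft, c, 1, -1, 0))"
| "instruction SweepLeft a b c = (if b = Sep then (Scan, c, 0, 0, 0) else (SweepStay, c, 1, -1, -1))"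
  \<comment> \<open>all digits were nines so far; a digit other than 9 leads to \<open>Found\<close>\<close>
| "instruction Scan a b c =
     (case c of Digit n \<Rightarrow> (if n = 9 then Scan else Found, c, 0, 0, -1) | _ \<Rightarrow> (Resume, c, 0, 0, 1))"
| "instruction Found a b c =
     (case c of Digit n \<Rightarrow> (Found, c, 0, 0, -1) | Aux n \<Rightarrow> (Output (Digit n), c, 0, 0, 0)
      | _ \<Rightarrow> (Resume, c, 0, 0, 1))"
| "instruction Resume a b c = (if fresh c then (Open, c, 0, 1, 0) else (Resume, c, 0, 0, 1))"
| "instruction (Output s) a b c = (if c = Blank then (Erase s, c, 0, 0, -1) else (Output s, c, 0, 0, 1))"
| "instruction (Erase s) a b c = (if c = Blank then (Write s, c, 0, 0, 1) else (Erase s, Blank, 0, 0, -1))"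
| "instruction (Write s) a b c = (Halt, s, 0, 0, 0)"
| "instruction Halt a b c = (Halt, c, 0, 0, 0)"

definition tape_symbols :: "symbol set" where
  "tape_symbols = Digit ` {0..9} \<union> Aux ` {0..9} \<union> {Minus, Sep, Blank}"

definition phases :: "phase set" where
  "phases = {FindSep, ReadBit, Double, Double', CopyBack, SkipInput, Fill, Unfill, Seek1, Seek2, Open,
     Multiply, Return, Sweep, SweepStay, SweepLeft, Scan, Found, Resume, Halt} \<union>
     Table ` {0..13} \<union> Add ` {0..81} \<union> Output ` tape_symbols \<union> Erase ` tape_symbols \<union> Write ` tape_symbols"

text \<open>
  Phases become natural numbers by an arbitrary injection.
\<close>
definition mult_machine :: "nat machine" where
  "mult_machine = \<lparr>states = to_nat ` phases, initial = to_nat FindSep, terminal = to_nat Halt,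
     tape_alphabet = tape_symbols,
     instr = (\<lambda>q a b c. case instruction (from_nat q) a b c of (q', r) \<Rightarrow> (to_nat q', r))\<rparr>"

lemma digit_of_le: "c \<in> tape_symbols \<Longrightarrow> digit_of c \<le> 9"
  by (auto simp: tape_symbols_def)

lemma set_digit_in: "n \<le> 9 \<Longrightarrow> set_digit c n \<in> tape_symbols"
  by (cases c) (auto simp: tape_symbols_def)

lemma Digit_in_tape_symbols [simp]: "Digit n \<in> tape_symbols \<longleftrightarrow> n \<le> 9"
  and Aux_in_tape_symbols [simp]: "Aux n \<in> tape_symbols \<longleftrightarrow> n \<le> 9"
  and special_in_tape_symbols [simp]: "Minus \<in> tape_symbols" "Sep \<in> tape_symbols" "Blank \<in> tape_symbols"
  by (auto simp: tape_symbols_def)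

lemma in_phases [simp]:
  "FindSep \<in> phases" "ReadBit \<in> phases" "Double \<in> phases" "Double' \<in> phases" "CopyBack \<in> phases"
  "SkipInput \<in> phases" "Fill \<in> phases" "Unfill \<in> phases" "Seek1 \<in> phases" "Seek2 \<in> phases"
  "Open \<in> phases" "Multiply \<in> phases" "Return \<in> phases" "Sweep \<in> phases" "SweepStay \<in> phases"
  "SweepLeft \<in> phases" "Scan \<in> phases" "Found \<in> phases" "Resume \<in> phases" "Halt \<in> phases"
  "Table i \<in> phases \<longleftrightarrow> i \<le> 13" "Add v \<in> phases \<longleftrightarrow> v \<le> 81" "Output s \<in> phases \<longleftrightarrow> s \<in> tape_symbols"
  "Erase s \<in> phases \<longleftrightarrow> s \<in> tape_symbols" "Write s \<in> phases \<longleftrightarrow> s \<in> tape_symbols"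
  by (simp_all add: phases_def image_iff)

text \<open>
  A digit plus a pending amount of at most \<open>81 = 9 * 9\<close> leaves a carry of at most \<open>9\<close>, so the pending amounts stay
  within a finite range.
\<close>
lemma instruction_closed:
  assumes q: "q \<in> phases" and abc: "a \<in> tape_symbols" "b \<in> tape_symbols" "c \<in> tape_symbols"
  shows "instruction q a b c \<in> phases \<times> tape_symbols \<times> {-1, 0, 1} \<times> {-1, 0, 1} \<times> {-1, 0, 1}"
proof (cases q)
  case Multiply
  have "digit_of a * digit_of b \<le> 9 * 9"
    using abc by (intro mult_le_mono digit_of_le)
  then show ?thesis using Multiply abc by simp
next
  case (Add v)
  then have "v \<le> 81" using q by simp
  with digit_of_le[OF abc(3)] have "(digit_of c + v) div 10 \<le> 81" by simp
  moreover have "set_digit c ((digit_of c + v) mod 10) \<in> tape_symbols"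
    by (rule set_digit_in) simp
  ultimately show ?thesis using Add abc by simp
next
  case (Table i)
  then show ?thesis using abc q by (simp add: table_symbol_def)
next
  case Scan
  then show ?thesis using abc by (cases c) simp_all
next
  case Found
  then show ?thesis using abc by (cases c) simp_all
qed (use abc q in simp_all)

lemma is_machine_mult_machine: "is_machine A_R mult_machine"
proof -
  have "finite tape_symbols" "finite phases"
    by (simp_all add: tape_symbols_def phases_def)
  moreover have "A_R \<union> {Digit 0, Digit 1, Blank, Sep} \<subseteq> tape_symbols"
    by (auto simp: A_R_def)
  moreover have "instr mult_machine q a b c \<in>
      to_nat ` phases \<times> tape_symbols \<times> {-1, 0, 1} \<times> {-1, 0, 1} \<times> {-1, 0, 1}"
    if q: "q \<in> to_nat ` phases" and abc: "a \<in> tape_symbols" "b \<in> tape_symbols" "c \<in> tape_symbols"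
    for q a b c
  proof -
    obtain q' where q': "q' \<in> phases" "q = to_nat q'" using q by blast
    obtain q'' r where r: "instruction q' a b c = (q'', r)" by (cases "instruction q' a b c")
    show ?thesis
      using instruction_closed[OF q'(1) abc] by (simp add: mult_machine_def q'(2) r)
  qed
  ultimately show ?thesis
    by (simp add: is_machine_def) (simp add: mult_machine_def)
qed

section \<open>Runs of the machine\<close>

definition cfg :: "phase \<Rightarrow> tape \<Rightarrow> int \<Rightarrow> int \<Rightarrow> int \<Rightarrow> nat config" where
  "cfg q T i j l = \<lparr>state = to_nat q, tape3 = T, head1 = i, head2 = j, head3 = l\<rparr>"

lemma step_cfg:
  assumes "instruction q (word_tape x i) (word_tape y j) (T l) = (q', s, di, dj, dl)" "q \<noteq> Halt"
  shows "step mult_machine x y (cfg q T i j l) = cfg q' (T(l := s)) (i + di) (j + dj) (l + dl)"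
  using assms by (simp add: step_def cfg_def mult_machine_def)

text \<open>
  What the machine notices of two code words: \<open>a\<close> and \<open>b\<close> are the cells of their separators, and \<open>D\<close>
  and \<open>E\<close> the digits behind them. The symbols before the separators only have to be different from it.
\<close>
locale two_words =
  fixes x y :: "symbol word" and a b :: int and D E :: "nat \<Rightarrow> nat"
  assumes header_x: "0 \<le> a" "word_tape x a = Sep" "\<And>i. i < a \<Longrightarrow> word_tape x i \<noteq> Sep"
    and digits_x: "\<And>i. word_tape x (a + 1 + int i) = Digit (D i)"
    and header_y: "0 \<le> b" "word_tape y b = Sep" "\<And>i. i < b \<Longrightarrow> word_tape y i \<noteq> Sep"
    and digits_y: "\<And>i. word_tape y (b + 1 + int i) = Digit (E i)"
    and blank_x: "\<And>i. word_tape x i = Blank \<longleftrightarrow> i < 0"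
    and blank_y: "\<And>i. word_tape y i = Blank \<longleftrightarrow> i < 0"
begin

abbreviation "X \<equiv> word_tape x"
abbreviation "Y \<equiv> word_tape y"

definition reaches :: "nat config \<Rightarrow> nat config \<Rightarrow> bool" (infix "\<leadsto>" 50) where
  "c \<leadsto> c' \<longleftrightarrow> (\<exists>t. (step mult_machine x y ^^ t) c = c')"

lemma reaches_refl [simp]: "c \<leadsto> c"
  unfolding reaches_def by (rule exI[of _ 0]) simp

lemma reaches_trans [trans]: "c \<leadsto> c' \<Longrightarrow> c' \<leadsto> c'' \<Longrightarrow> c \<leadsto> c''"
  unfolding reaches_def
proof (elim exE)
  fix t t' assume "(step mult_machine x y ^^ t) c = c'" "(step mult_machine x y ^^ t') c' = c''"
  then have "(step mult_machine x y ^^ (t' + t)) c = c''" by (simp add: funpow_add)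
  then show "\<exists>t. (step mult_machine x y ^^ t) c = c''" ..
qed

lemma write_move:
  assumes "instruction q (X i) (Y j) (T l) = (q', s, i' - i, j' - j, l' - l)"
    "q \<noteq> Halt" "T' = T(l := s)"
  shows "cfg q T i j l \<leadsto> cfg q' T' i' j' l'"
  unfolding reaches_def
  by (rule exI[of _ 1]) (use step_cfg[of q x i y j T l q' s "i' - i" "j' - j" "l' - l"] assms in simp)

lemma move:
  assumes "instruction q (X i) (Y j) (T l) = (q', T l, i' - i, j' - j, l' - l)" "q \<noteq> Halt"
  shows "cfg q T i j l \<leadsto> cfg q' T i' j' l'"
  by (rule write_move[where s = "T l"]) (use assms in simp_all)

lemma repeat_move:
  assumes "\<And>k. k < n \<Longrightarrow> instruction q (X (i + int k * di)) (Y (j + int k * dj)) (T (l + int k * dl))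
      = (q, T (l + int k * dl), di, dj, dl)" "q \<noteq> Halt"
  shows "cfg q T i j l \<leadsto> cfg q T (i + int n * di) (j + int n * dj) (l + int n * dl)"
  using assms(1)
proof (induction n)
  case (Suc n)
  have "cfg q T i j l \<leadsto> cfg q T (i + int n * di) (j + int n * dj) (l + int n * dl)"
    using Suc by simp
  also have "\<dots> \<leadsto> cfg q T (i + int (Suc n) * di) (j + int (Suc n) * dj) (l + int (Suc n) * dl)"
    by (rule move) (use Suc.prems[of n] assms(2) in \<open>simp_all add: algebra_simps\<close>)
  finally show ?case .
qed simp

lemma scan_right:
  assumes "\<And>k. l \<le> k \<Longrightarrow> k < l' \<Longrightarrow> instruction q (X i) (Y j) (T k) = (q, T k, 0, 0, 1)"
    "q \<noteq> Halt" "l \<le> l'"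
  shows "cfg q T i j l \<leadsto> cfg q T i j l'"
  using repeat_move[of "nat (l' - l)" q i 0 j 0 T l 1] assms by auto

lemma scan_left:
  assumes "\<And>k. l' < k \<Longrightarrow> k \<le> l \<Longrightarrow> instruction q (X i) (Y j) (T k) = (q, T k, 0, 0, -1)"
    "q \<noteq> Halt" "l' \<le> l"
  shows "cfg q T i j l \<leadsto> cfg q T i j l'"
  using repeat_move[of "nat (l - l')" q i 0 j 0 T l "-1"] assms by auto

text \<open>
  Cells \<open>0\<close> to \<open>r - 1\<close> are not blank and all others are, so both ends of the written region, and with the
  left one cell \<open>0\<close>, can be found without a mark.
\<close>
lemma output_reaches:
  assumes inside: "\<And>k. 0 \<le> k \<Longrightarrow> k < r \<Longrightarrow> T k \<noteq> Blank"
    and outside: "\<And>k. k < 0 \<Longrightarrow> T k = Blank" "\<And>k. r \<le> k \<Longrightarrow> T k = Blank"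
    and l: "0 \<le> l" "l \<le> r"
  shows "cfg (Output s) T i j l \<leadsto> cfg Halt (list_tape [s]) i j 0"
proof -
  define T' where "T' = (\<lambda>n k. if k < n then T k else Blank)"
  have T'_r: "T' r = T" using outside by (auto simp: T'_def)
  have T'_0: "T' 0 = (\<lambda>_. Blank)" using outside by (auto simp: T'_def)
  have erase: "cfg (Erase s) (T' (int n)) i j (int n - 1) \<leadsto> cfg (Erase s) (\<lambda>_. Blank) i j (-1)"
    if "int n \<le> r" for n
    using that
  proof (induction n)
    case (Suc n)
    have "cfg (Erase s) (T' (int (Suc n))) i j (int (Suc n) - 1)
        \<leadsto> cfg (Erase s) (T' (int n)) i j (int n - 1)"
      by (rule write_move) (use Suc.prems inside[of "int n"] in \<open>auto simp: T'_def\<close>)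
    also have "\<dots> \<leadsto> cfg (Erase s) (\<lambda>_. Blank) i j (-1)" using Suc by simp
    finally show ?case .
  qed (simp add: T'_0)
  have "cfg (Output s) T i j l \<leadsto> cfg (Output s) T i j r"
    by (rule scan_right) (use inside l in auto)
  also have "\<dots> \<leadsto> cfg (Erase s) T i j (r - 1)"
    by (rule move) (use outside in auto)
  also have "\<dots> \<leadsto> cfg (Erase s) (\<lambda>_. Blank) i j (-1)"
    using erase[of "nat r"] l by (simp add: T'_r)
  also have "\<dots> \<leadsto> cfg (Write s) (\<lambda>_. Blank) i j 0"
    by (rule move) auto
  also have "\<dots> \<leadsto> cfg Halt (list_tape [s]) i j 0"
    by (rule write_move) (auto simp: list_tape_def)
  finally show ?thesis .
qed

end

section \<open>Reading the input\<close>

lemma length_binary: "n div 2 ^ length (binary n) = 0"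
  and nth_binary: "k < length (binary n) \<Longrightarrow> binary n ! k = Digit (n div 2 ^ k mod 2)"
proof (induction n arbitrary: k rule: binary.induct)
  case (1 n)
  { case 1 show ?case
    proof (cases "n < 2")
      case False
      then show ?thesis using "1.IH"(1) by (subst binary.simps) (simp add: div_mult2_eq)
    qed (simp add: binary.simps)
  next
    case 2 then show ?case
    proof (cases "n < 2")
      case False
      then show ?thesis using "1.IH"(2)[of "k - 1"] 2
        by (subst binary.simps) (cases k; subst (asm) binary.simps; simp add: div_mult2_eq)
    next
      case True
      then show ?thesis using 2 by (simp add: binary.simps)
    qed
  }
qed

definition written :: "tape \<Rightarrow> int \<Rightarrow> symbol list \<Rightarrow> bool" where
  "written T l u \<longleftrightarrow> (\<forall>k<length u. T (l + int k) = u ! k)"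

lemma written_append [simp]:
  "written T l (u @ v) \<longleftrightarrow> written T l u \<and> written T (l + int (length u)) v"
proof -
  have "(\<forall>k<length u + length v. T (l + int k) = (u @ v) ! k) \<longleftrightarrow>
      (\<forall>k<length u. T (l + int k) = u ! k) \<and> (\<forall>k<length v. T (l + int (length u) + int k) = v ! k)"
    (is "?L \<longleftrightarrow> ?R")
  proof
    assume L: ?L
    have "T (l + int (length u) + int k) = v ! k" if "k < length v" for k
      using L[rule_format, of "length u + k"] that by (simp add: add.assoc)
    with L show ?R by (auto simp: nth_append)
  next
    assume R: ?R
    show ?L
    proof (intro allI impI)
      fix k assume k: "k < length u + length v"
      show "T (l + int k) = (u @ v) ! k"
      proof (cases "k < length u")
        case False
        then have "T (l + int (length u) + int (k - length u)) = v ! (k - length u)"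
          using R k by (intro conjunct2[OF R, rule_format]) simp
        with False show ?thesis by (simp add: nth_append of_nat_diff)
      qed (use R in \<open>simp add: nth_append\<close>)
    qed
  qed
  then show ?thesis by (simp add: written_def)
qed

lemma written_Cons [simp]: "written T l (s # u) \<longleftrightarrow> T l = s \<and> written T (l + 1) u"
  using written_append[of T l "[s]" u] by (simp add: written_def)

lemma written_Nil [simp]: "written T l []"
  by (simp add: written_def)

lemma written_list_tape [simp]: "written (list_tape w) 0 w"
  by (simp add: written_def list_tape_def)

text \<open>
  Entry \<open>c\<close> is written as \<open>c\<close> zeros and a one. Reading it needs only a counter in the finite memory, and the
  last digit is \<open>1\<close>, as it must be in a binary numeral that starts with the least significant digit.
\<close>
definition table_bits :: "nat list \<Rightarrow> symbol list" where
  "table_bits cs = concat (map (\<lambda>c. replicate c (Digit 0) @ [Digit 1]) cs)"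

lemma table_bits_simps [simp]:
  "table_bits [] = []"
  "table_bits (c # cs) = replicate c (Digit 0) @ Digit 1 # table_bits cs"
  "table_bits (cs @ cs') = table_bits cs @ table_bits cs'"
  by (simp_all add: table_bits_def)

lemma set_table_bits: "set (table_bits cs) \<subseteq> {Digit 0, Digit 1}"
  by (induction cs) auto

context two_words begin

text \<open>
  Left of cell \<open>0\<close> the input tapes are blank and a head can tell whether it has come back to cell \<open>0\<close>. So
  the heads are counters with a test for zero; one counter is moved to the other at double speed.
\<close>
lemma double_head:
  "cfg Double T (- int v) 0 l \<leadsto> cfg CopyBack T 0 (- 2 * int v) l"
proof -
  have "cfg Double T (- int v) j l \<leadsto> cfg Double T 0 (j - 2 * int v) l" for j
  proof (induction v arbitrary: j)
    case (Suc v)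
    have "cfg Double T (- int (Suc v)) j l \<leadsto> cfg Double' T (- int v) (j - 1) l"
      by (rule move) (simp_all add: blank_x)
    also have "\<dots> \<leadsto> cfg Double T (- int v) (j - 2) l"
      by (rule move) simp_all
    also have "\<dots> \<leadsto> cfg Double T 0 (j - 2 - 2 * int v) l" by (rule Suc)
    finally show ?case by (simp add: algebra_simps)
  qed simp
  from this[of 0] have "cfg Double T (- int v) 0 l \<leadsto> cfg Double T 0 (- 2 * int v) l" by simp
  also have "\<dots> \<leadsto> cfg CopyBack T 0 (- 2 * int v) l"
    by (rule move) (simp_all add: blank_x)
  finally show ?thesis .
qed

lemma read_bit:
  assumes "T l = Digit c" "c < 2"
  shows "cfg ReadBit T (- int v) 0 l \<leadsto> cfg ReadBit T (- int (2 * v + c)) 0 (l - 1)"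
proof -
  have "cfg ReadBit T (- int v) 0 l \<leadsto> cfg Double T (- int v) 0 l"
    by (rule move) (simp_all add: assms)
  also have "\<dots> \<leadsto> cfg CopyBack T 0 (- 2 * int v) l" by (rule double_head)
  also have "\<dots> \<leadsto> cfg CopyBack T (- 2 * int v) 0 l"
    using repeat_move[of "2 * v" CopyBack 0 "-1" "- 2 * int v" 1 T l 0] by (simp add: blank_y)
  also have "\<dots> \<leadsto> cfg ReadBit T (- int (2 * v + c)) 0 (l - 1)"
    by (rule move) (use assms in \<open>auto simp: blank_y\<close>)
  finally show ?thesis .
qed

text \<open>
  Horner's scheme: after the digits above place \<open>k\<close> have been read, head 1 stands at \<open>- (m div 2 ^ k)\<close>.
\<close>
lemma read_input:
  assumes "written T 0 (binary m @ [Sep])" "T (- 1) = Blank"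
  shows "cfg FindSep T 0 0 0 \<leadsto> cfg (Table 0) T (- int m) 0 (int (length (binary m)) + 1)"
proof -
  let ?n = "length (binary m)"
  have bit: "T (int k) = Digit (m div 2 ^ k mod 2)" if "k < ?n" for k
    using assms(1) that nth_binary[of k m] by (simp add: written_def nth_append)
  have bit': "\<exists>c. T k = Digit c" if "0 \<le> k" "k < int ?n" for k
    using bit[of "nat k"] that by auto
  have Sep: "T (int ?n) = Sep" using assms(1) by simp
  have read: "cfg ReadBit T (- int (m div 2 ^ k)) 0 (int k - 1) \<leadsto> cfg ReadBit T (- int m) 0 (- 1)"
    if "k \<le> ?n" for k
    using that
  proof (induction k)
    case (Suc k)
    have "m div 2 ^ k = 2 * (m div 2 ^ Suc k) + m div 2 ^ k mod 2"
      by (simp add: div_mult2_eq mult.commute[of 2])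
    then have "cfg ReadBit T (- int (m div 2 ^ Suc k)) 0 (int (Suc k) - 1)
        \<leadsto> cfg ReadBit T (- int (m div 2 ^ k)) 0 (int k - 1)"
      using read_bit[of T "int k" "m div 2 ^ k mod 2" "m div 2 ^ Suc k"] bit[of k] Suc.prems by simp
    also have "\<dots> \<leadsto> cfg ReadBit T (- int m) 0 (- 1)" using Suc by simp
    finally show ?case .
  qed simp
  have "cfg FindSep T 0 0 0 \<leadsto> cfg FindSep T 0 0 (int ?n)"
    by (rule scan_right) (auto dest: bit')
  also have "\<dots> \<leadsto> cfg ReadBit T 0 0 (int ?n - 1)"
    by (rule move) (simp_all add: Sep)
  also have "\<dots> \<leadsto> cfg ReadBit T (- int m) 0 (- 1)"
    using read[of ?n] by (simp add: length_binary)
  also have "\<dots> \<leadsto> cfg SkipInput T (- int m) 0 0"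
    by (rule move) (simp_all add: assms)
  also have "\<dots> \<leadsto> cfg SkipInput T (- int m) 0 (int ?n)"
    by (rule scan_right) (auto dest: bit')
  also have "\<dots> \<leadsto> cfg (Table 0) T (- int m) 0 (int ?n + 1)"
    by (rule move) (simp_all add: Sep)
  finally show ?thesis .
qed

lemma read_code:
  assumes "written T l (replicate c (Digit 0))" "c \<le> 13"
  shows "cfg (Table 0) T i j l \<leadsto> cfg (Table c) T i j (l + int c)"
  using assms
proof (induction c)
  case (Suc c)
  have T: "written T l (replicate c (Digit 0))" "T (l + int c) = Digit 0"
    using Suc.prems(1) by (simp_all only: written_append replicate_append_same[symmetric]
      replicate_Suc length_replicate) simp_all
  have "cfg (Table 0) T i j l \<leadsto> cfg (Table c) T i j (l + int c)"
    using Suc T by simp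
  also have "\<dots> \<leadsto> cfg (Table (Suc c)) T i j (l + int (Suc c))"
    by (rule move) (use Suc.prems T in simp_all)
  finally show ?case .
qed simp

text \<open>
  Each symbol entry moves head 1 one cell towards cell \<open>0\<close>, so the distance that remains is the number of entries
  still to be skipped.
\<close>
lemma skip_symbols:
  assumes "written T l (table_bits cs)" "\<forall>c\<in>set cs. c < 12" "length cs \<le> m"
  shows "cfg (Table 0) T (- int m) j l
    \<leadsto> cfg (Table 0) T (- int (m - length cs)) j (l + int (length (table_bits cs)))"
  using assms
proof (induction cs arbitrary: l m)
  case (Cons c cs)
  have "cfg (Table 0) T (- int m) j l \<leadsto> cfg (Table c) T (- int m) j (l + int c)"
    using Cons.prems by (intro read_code) auto
  also have "\<dots> \<leadsto> cfg (Table 0) T (- int (m - 1)) j (l + int c + 1)"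
    by (rule move) (use Cons.prems in \<open>auto simp: blank_x\<close>)
  also have "\<dots> \<leadsto> cfg (Table 0) T (- int (m - 1 - length cs)) j
      (l + int c + 1 + int (length (table_bits cs)))"
    using Cons.prems by (intro Cons.IH) auto
  finally show ?case by (simp add: algebra_simps)
qed simp

lemma output_symbol:
  assumes "written T l (table_bits cs)" "\<forall>c\<in>set cs. c < 12" "m < length cs"
  shows "\<exists>i l'. cfg (Table 0) T (- int m) j l \<leadsto> cfg (Output (table_symbol (cs ! m))) T i j l' \<and>
    l \<le> l' \<and> l' \<le> l + int (length (table_bits cs))"
proof -
  define us where "us = take m cs"
  have cs: "cs = us @ cs ! m # drop (Suc m) cs" unfolding us_def using assms(3) by (rule id_take_nth_drop)
  have us: "length us = m" "set us \<subseteq> set cs" using assms(3) by (auto simp: us_def dest: in_set_takeD)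
  let ?k = "l + int (length (table_bits us))"
  have T: "written T l (table_bits us)" "written T ?k (replicate (cs ! m) (Digit 0))"
      "T (?k + int (cs ! m)) = Digit 1"
    using assms(1) by (subst (asm) cs; simp)+
  have lt: "cs ! m < 12" using assms by simp
  have "cfg (Table 0) T (- int m) j l \<leadsto> cfg (Table 0) T 0 j ?k"
    using skip_symbols[OF T(1), of m j] us assms(2) by auto
  also have "\<dots> \<leadsto> cfg (Table (cs ! m)) T 0 j (?k + int (cs ! m))"
    using T(2) lt by (intro read_code) auto
  also have "\<dots> \<leadsto> cfg (Output (table_symbol (cs ! m))) T 0 j (?k + int (cs ! m))"
    by (rule move) (use T(3) lt in \<open>auto simp: blank_x\<close>)
  finally have "cfg (Table 0) T (- int m) j l
      \<leadsto> cfg (Output (table_symbol (cs ! m))) T 0 j (?k + int (cs ! m))" .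
  moreover have "length (table_bits cs) = length (table_bits us) + (cs ! m + Suc (length (table_bits (drop (Suc m) cs))))"
    by (subst cs) simp
  ultimately show ?thesis
    by (intro exI[of _ 0] exI[of _ "?k + int (cs ! m)"]) simp
qed

lemma skip_padding:
  assumes "written T l (table_bits (replicate s 12))"
  shows "cfg (Table 0) T (- int m) j l
    \<leadsto> cfg (Table 0) T (- int (m + s)) j (l + int (length (table_bits (replicate s 12))))"
  using assms
proof (induction s arbitrary: l m)
  case (Suc s)
  have "cfg (Table 0) T (- int m) j l \<leadsto> cfg (Table 12) T (- int m) j (l + int 12)"
    using Suc.prems by (intro read_code) auto
  also have "\<dots> \<leadsto> cfg (Table 0) T (- int (m + 1)) j (l + int 12 + 1)"
    by (rule move) (use Suc.prems in simp_all)
  also have "\<dots> \<leadsto> cfg (Table 0) T (- int (m + 1 + s)) j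
      (l + int 12 + 1 + int (length (table_bits (replicate s 12))))"
    using Suc.prems by (intro Suc.IH) auto
  finally show ?case by (simp add: algebra_simps)
qed simp

end

section \<open>Long multiplication on the tape\<close>

text \<open>
  The work tape with \<open>n\<close> open columns, which show the number \<open>s\<close>. Column \<open>0\<close> is in cell \<open>C\<close>, preceded by one cell for
  the leading digit; column \<open>p\<close> is marked. To the left is the input \<open>T\<close>.
\<close>
definition column_tape :: "tape \<Rightarrow> int \<Rightarrow> nat \<Rightarrow> nat \<Rightarrow> nat \<Rightarrow> tape" where
  "column_tape T C p n s = (\<lambda>c.
     if c < C - 1 then T c
     else if c < C + int n then
       (if c = C + int p then Aux else Digit) (s div 10 ^ nat (C + int n - 1 - c) mod 10)
     else if c < C + int p then Minus
     else if c = C + int p then Sep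
     else Blank)"

text \<open>
  The separator of \<open>m\<close> and \<open>h\<close> is in cell \<open>M\<close>, and \<open>h\<close> ends in cell \<open>C - 2\<close>.
\<close>
locale columns = two_words +
  fixes T :: tape and M C :: int and p :: nat
  assumes layout: "0 \<le> M" "M + 1 < C - 1"
    and T_sep: "T M = Sep"
    and T_bits: "\<And>c. M < c \<Longrightarrow> c < C - 1 \<Longrightarrow> T c \<in> {Digit 0, Digit 1}"
    and T_inside: "\<And>c. 0 \<le> c \<Longrightarrow> c < M \<Longrightarrow> T c \<noteq> Blank"
    and T_outside: "\<And>c. c < 0 \<Longrightarrow> T c = Blank" "\<And>c. C - 1 \<le> c \<Longrightarrow> T c = Blank"
    and column_bound: "\<And>n. column_sum D E n < 10 ^ Suc n"
begin

abbreviation "tape \<equiv> column_tape T C p"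
abbreviation "csum \<equiv> column_sum D E"
abbreviation "settled \<equiv> digit_settled D E p"

lemma fill_columns:
  "cfg (Table 0) T (- int p) 0 (C - 1) \<leadsto> cfg Open (tape 0 0) (a + 1) (b + 1) C"
proof -
  define F where "F = (\<lambda>k c. if c < C - 1 then T c else if c = C - 1 then Digit 0
     else if c < C + int k then Minus else Blank)"
  have "cfg (Table 0) T (- int p) 0 (C - 1) \<leadsto> cfg Fill (F 0) (- int p) 0 C"
    by (rule write_move[where s = "Digit 0"]) (auto simp: T_outside F_def)
  also have "\<dots> \<leadsto> cfg Fill (F p) 0 0 (C + int p)"
  proof -
    have "cfg Fill (F 0) (- int p) 0 C \<leadsto> cfg Fill (F k) (- int (p - k)) 0 (C + int k)" if "k \<le> p" for k
      using that
    proof (induction k)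
      case (Suc k)
      have "cfg Fill (F 0) (- int p) 0 C \<leadsto> cfg Fill (F k) (- int (p - k)) 0 (C + int k)"
        using Suc by simp
      also have "\<dots> \<leadsto> cfg Fill (F (Suc k)) (- int (p - Suc k)) 0 (C + int (Suc k))"
        by (rule write_move[where s = Minus]) (use Suc.prems in \<open>auto simp: blank_x F_def\<close>)
      finally show ?case .
    qed simp
    from this[of p] show ?thesis by simp
  qed
  also have "\<dots> \<leadsto> cfg Unfill (tape 0 0) 0 0 (C + int p - 1)"
    by (rule write_move[where s = Sep]) (auto simp: blank_x F_def column_tape_def)
  also have "\<dots> \<leadsto> cfg Unfill (tape 0 0) 0 0 (C - 1)"
    by (rule scan_left) (auto simp: column_tape_def)
  also have "\<dots> \<leadsto> cfg Seek1 (tape 0 0) 0 0 C"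
    by (rule move) (auto simp: column_tape_def)
  also have "\<dots> \<leadsto> cfg Seek1 (tape 0 0) a 0 C"
    using repeat_move[of "nat a" Seek1 0 1 0 0 "tape 0 0" C 0] header_x by simp
  also have "\<dots> \<leadsto> cfg Seek2 (tape 0 0) (a + 1) 0 C"
    by (rule move) (simp_all add: header_x)
  also have "\<dots> \<leadsto> cfg Seek2 (tape 0 0) (a + 1) b C"
    using repeat_move[of "nat b" Seek2 "a + 1" 0 0 1 "tape 0 0" C 0] header_y by simp
  also have "\<dots> \<leadsto> cfg Open (tape 0 0) (a + 1) (b + 1) C"
    by (rule move) (simp_all add: header_y)
  finally show ?thesis .
qed

lemma fresh_tape: "M < c \<Longrightarrow> fresh (tape n s c) \<longleftrightarrow> C + int n \<le> c"
  using T_bits[of c] by (auto simp: column_tape_def fresh_def)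

text \<open>
  A new column is a digit \<open>0\<close> appended to the number, which multiplies it by \<open>10\<close>.
\<close>
lemma open_column:
  "cfg Open (tape n s) i j (C + int n) \<leadsto> cfg Multiply (tape (Suc n) (10 * s)) i j (C + int n)"
proof (rule write_move[where s = "if tape n s (C + int n) = Sep then Aux 0 else Digit 0"])
  have "10 * s div 10 ^ nat (C + int n - c) = s div 10 ^ nat (C + int n - 1 - c)" if "c < C + int n" for c
  proof -
    have "nat (C + int n - c) = Suc (nat (C + int n - 1 - c))" using that by simp
    then show ?thesis by (simp add: div_mult2_eq)
  qed
  then show "tape (Suc n) (10 * s) = (tape n s)
      (C + int n := if tape n s (C + int n) = Sep then Aux 0 else Digit 0)"
    by (auto simp: column_tape_def fun_eq_iff)
qed auto

lemma return_to_column: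
  assumes "M < l" "l \<le> C + int (Suc n)"
  shows "cfg Return (tape (Suc n) s) i j l
    \<leadsto> cfg Multiply (tape (Suc n) s) (i - 1) (j + 1) (C + int n)"
proof -
  have "cfg Return (tape (Suc n) s) i j l \<leadsto> cfg Return (tape (Suc n) s) i j (C + int (Suc n))"
    by (rule scan_right) (use assms fresh_tape[of _ "Suc n" s] in auto)
  also have "\<dots> \<leadsto> cfg Multiply (tape (Suc n) s) (i - 1) (j + 1) (C + int n)"
    by (rule move) (use assms fresh_tape[of "C + int (Suc n)" "Suc n" s] layout in auto)
  finally show ?thesis .
qed

text \<open>
  Describes the carry by what it achieves: when the last \<open>t\<close> digits of the sum \<open>s'\<close> are in place, the pending amount is
  \<open>s' div 10 ^ t - s div 10 ^ t\<close>.
\<close>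
lemma add_step:
  fixes s s' t :: nat
  assumes "s \<le> s'"
  defines "v \<equiv> s' div 10 ^ t - s div 10 ^ t"
  shows "(s div 10 ^ t mod 10 + v) mod 10 = s' div 10 ^ t mod 10"
    and "(s div 10 ^ t mod 10 + v) div 10 = s' div 10 ^ Suc t - s div 10 ^ Suc t"
proof -
  define u u' where "u = s div 10 ^ t" and "u' = s' div 10 ^ t"
  have "u \<le> u'" unfolding u_def u'_def using assms(1) by (rule div_le_mono)
  then obtain w where w: "u' = u + w" by (rule less_eqE)
  then have v: "v = w" by (simp add: v_def u_def u'_def)
  show "(s div 10 ^ t mod 10 + v) mod 10 = s' div 10 ^ t mod 10"
    using w mod_add_left_eq[of u 10 w] by (simp add: v u_def u'_def)
  have "u + w = u mod 10 + w + u div 10 * 10" by simp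
  then have "(u + w) div 10 = (u mod 10 + w + u div 10 * 10) div 10" by (rule arg_cong)
  also have "\<dots> = u div 10 + (u mod 10 + w) div 10" by (rule div_mult_self1) simp
  finally have "(u mod 10 + w) div 10 = u' div 10 - u div 10" by (simp add: w)
  then show "(s div 10 ^ t mod 10 + v) div 10 = s' div 10 ^ Suc t - s div 10 ^ Suc t"
    by (simp add: v u_def u'_def div_mult2_eq mult.commute[of 10])
qed

lemma add_product:
  assumes "s' < 10 ^ (n + 2)" "s' = s + v"
  shows "cfg (Add v) (tape (Suc n) s) i j (C + int n)
    \<leadsto> cfg Multiply (tape (Suc n) s') (i - 1) (j + 1) (C + int n)"
proof -
  \<comment> \<open>the tape when the last \<open>t\<close> digits have been replaced by those of the sum, and the pending amount\<close>
  define G where "G = (\<lambda>t c. if C + int n - int t < c then tape (Suc n) s' c else tape (Suc n) s c)"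
  define w where "w = (\<lambda>t. s' div 10 ^ t - s div 10 ^ t)"
  have "s \<le> s'" using assms by simp
  have "cfg (Add (w t)) (G t) i j (C + int n - int t)
    \<leadsto> cfg Multiply (tape (Suc n) s') (i - 1) (j + 1) (C + int n)" if "t \<le> n + 2" for t
    using that
  proof (induction t rule: inc_induct)
    case base
    have small: "s' div 10 ^ (n + 2) = 0" "s div 10 ^ (n + 2) = 0" using assms by simp_all
    have "G (n + 2) = tape (Suc n) s'"
      by (auto simp: G_def column_tape_def fun_eq_iff)
    moreover have "w (n + 2) = 0" by (simp only: w_def small)
    ultimately have "cfg (Add (w (n + 2))) (G (n + 2)) i j (C + int n - int (n + 2))
        \<leadsto> cfg Return (tape (Suc n) s') i j (C - 2)"
      by (auto intro: move)
    also have "\<dots> \<leadsto> cfg Multiply (tape (Suc n) s') (i - 1) (j + 1) (C + int n)"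
      using layout by (intro return_to_column) auto
    finally show ?case .
  next
    case (step t)
    let ?l = "C + int n - int t"
    have exp: "nat (C + int (Suc n) - 1 - ?l) = t" by simp
    show ?case
    proof (cases "w t = 0")
      case True
      have "s' div 10 ^ r = s div 10 ^ r" if "t \<le> r" for r
      proof -
        have "s div 10 ^ t = s' div 10 ^ t"
          using True div_le_mono[OF \<open>s \<le> s'\<close>, of "10 ^ t"] by (simp add: w_def)
        then have "s div 10 ^ t div 10 ^ (r - t) = s' div 10 ^ t div 10 ^ (r - t)" by simp
        then show ?thesis using that by (simp add: div_mult2_eq[symmetric] power_add[symmetric])
      qed
      then have "tape (Suc n) s c = tape (Suc n) s' c" if "c \<le> ?l" for c
        using that by (simp add: column_tape_def)
      then have "G t = tape (Suc n) s'" by (auto simp: G_def fun_eq_iff)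
      then have "cfg (Add (w t)) (G t) i j ?l \<leadsto> cfg Return (tape (Suc n) s') i j ?l"
        using True by (auto intro: move)
      also have "\<dots> \<leadsto> cfg Multiply (tape (Suc n) s') (i - 1) (j + 1) (C + int n)"
        using layout step.hyps by (intro return_to_column) auto
      finally show ?thesis .
    next
      case False
      have t: "t \<le> n + 1" using step.hyps by simp
      have cell: "G t ?l = (if ?l = C + int p then Aux else Digit) (s div 10 ^ t mod 10)"
        using t by (auto simp: G_def column_tape_def)
      have dig: "digit_of (G t ?l) = s div 10 ^ t mod 10"
        by (simp add: cell)
      have set: "set_digit (G t ?l) d = (if ?l = C + int p then Aux else Digit) d" for d
        by (simp add: cell)
      have "cfg (Add (w t)) (G t) i j ?l \<leadsto> cfg (Add (w (Suc t))) (G (Suc t)) i j (C + int n - int (Suc t))"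
      proof (rule write_move[where s = "(if ?l = C + int p then Aux else Digit) (s' div 10 ^ t mod 10)"])
        show "instruction (Add (w t)) (X i) (Y j) (G t ?l) =
          (Add (w (Suc t)), (if ?l = C + int p then Aux else Digit) (s' div 10 ^ t mod 10), i - i, j - j,
           C + int n - int (Suc t) - ?l)"
          using False add_step[OF \<open>s \<le> s'\<close>, of t]
          by (simp add: dig set w_def del: power_Suc)
        have "tape (Suc n) s' ?l = (if ?l = C + int p then Aux else Digit) (s' div 10 ^ t mod 10)"
          using t by (auto simp: column_tape_def)
        then show "G (Suc t) = (G t)(?l := (if ?l = C + int p then Aux else Digit) (s' div 10 ^ t mod 10))"
          by (auto simp: G_def fun_eq_iff)
      qed simp
      also have "\<dots> \<leadsto> cfg Multiply (tape (Suc n) s') (i - 1) (j + 1) (C + int n)"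
        by (rule step.IH)
      finally show ?thesis .
    qed
  qed
  from this[of 0] have "cfg (Add (w 0)) (G 0) i j (C + int n)
    \<leadsto> cfg Multiply (tape (Suc n) s') (i - 1) (j + 1) (C + int n)" by simp
  moreover have "G 0 = tape (Suc n) s"
    by (auto simp: G_def column_tape_def fun_eq_iff)
  moreover have "w 0 = v" using assms by (simp add: w_def)
  ultimately show ?thesis by simp
qed

text \<open>
  Heads 1 and 2 visit the pairs \<open>(n, 0), (n - 1, 1), \<dots>, (0, n)\<close> of places, whose products make up column \<open>n\<close>.
\<close>
lemma add_column:
  "cfg Open (tape n (csum n)) (a + 1 + int n) (b + 1) (C + int n)
    \<leadsto> cfg Multiply (tape (Suc n) (csum (Suc n))) a (b + 2 + int n) (C + int n)"
proof -
  define s where "s = (\<lambda>r. 10 * csum n + (\<Sum>i<r. D (n - i) * E i))"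
  have "cfg Multiply (tape (Suc n) (s 0)) (a + 1 + int n) (b + 1) (C + int n)
    \<leadsto> cfg Multiply (tape (Suc n) (s r)) (a + 1 + int n - int r) (b + 1 + int r) (C + int n)"
    if "r \<le> Suc n" for r
    using that
  proof (induction r)
    case (Suc r)
    have "s (Suc r) \<le> s (Suc n)"
      unfolding s_def using Suc.prems by (intro add_left_mono sum_mono2) auto
    also have "s (Suc n) = csum (Suc n)" by (simp add: s_def lessThan_Suc_atMost)
    also have "\<dots> < 10 ^ (n + 2)" using column_bound[of "Suc n"] by simp
    finally have bound: "s (Suc r) < 10 ^ (n + 2)" .
    have x: "X (a + 1 + int n - int r) = Digit (D (n - r))"
      using digits_x[of "n - r"] Suc.prems by (simp add: of_nat_diff algebra_simps)
    have y: "Y (b + 1 + int r) = Digit (E r)" by (rule digits_y)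
    have "cfg Multiply (tape (Suc n) (s 0)) (a + 1 + int n) (b + 1) (C + int n)
      \<leadsto> cfg Multiply (tape (Suc n) (s r)) (a + 1 + int n - int r) (b + 1 + int r) (C + int n)"
      using Suc by simp
    also have "\<dots> \<leadsto> cfg (Add (D (n - r) * E r)) (tape (Suc n) (s r))
        (a + 1 + int n - int r) (b + 1 + int r) (C + int n)"
      by (rule move) (simp_all add: x y)
    also have "\<dots> \<leadsto> cfg Multiply (tape (Suc n) (s (Suc r))) (a + 1 + int n - int r - 1)
        (b + 1 + int r + 1) (C + int n)"
      by (rule add_product[OF bound]) (simp add: s_def)
    finally show ?case by (simp add: algebra_simps)
  qed simp
  from this[of "Suc n"]
  have "cfg Multiply (tape (Suc n) (10 * csum n)) (a + 1 + int n) (b + 1) (C + int n)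
    \<leadsto> cfg Multiply (tape (Suc n) (csum (Suc n))) a (b + 2 + int n) (C + int n)"
    by (simp add: s_def lessThan_Suc_atMost algebra_simps)
  then show ?thesis by (rule reaches_trans[OF open_column])
qed

text \<open>
  Head 1 takes \<open>n + 2\<close> steps from its separator to digit \<open>n + 1\<close>, where the next column starts, while head 2
  takes the same number of steps down to its separator, where the sweep ends. So head 3 moves
  \<open>2 + n div 2\<close> cells to the left of column \<open>n\<close>.
\<close>
lemma sweep_back:
  "cfg Multiply U a (b + 2 + int n) (C + int n)
    \<leadsto> cfg Scan U (a + 2 + int n) b (C + int n - 2 - int (n div 2))"
proof -
  have Y: "Y (b + 1 + int r) \<noteq> Sep" for r by (simp add: digits_y)
  have sweep: "cfg SweepStay U i (b + int r) l \<leadsto> cfg Scan U (i + int r) b (l - int (r div 2))"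
     and "cfg SweepLeft U i (b + int r) l \<leadsto> cfg Scan U (i + int r) b (l - int (Suc r div 2))" for r i l
  proof (induction r arbitrary: i l)
    case 0
    { case 1 show ?case by (rule move) (simp_all add: header_y) }
    { case 2 show ?case by (rule move) (simp_all add: header_y) }
  next
    case (Suc r)
    { case 1
      have "cfg SweepStay U i (b + int (Suc r)) l \<leadsto> cfg SweepLeft U (i + 1) (b + int r) l"
        by (rule move) (use Y[of r] in \<open>simp_all add: algebra_simps\<close>)
      also have "\<dots> \<leadsto> cfg Scan U (i + 1 + int r) b (l - int (Suc r div 2))" by (rule Suc)
      finally show ?case by (simp add: algebra_simps) }
    { case 2
      have "cfg SweepLeft U i (b + int (Suc r)) l \<leadsto> cfg SweepStay U (i + 1) (b + int r) (l - 1)"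
        by (rule move) (use Y[of r] in \<open>simp_all add: algebra_simps\<close>)
      also have "\<dots> \<leadsto> cfg Scan U (i + 1 + int r) b (l - 1 - int (r div 2))" by (rule Suc)
      finally show ?case by (simp add: algebra_simps) }
  qed
  have "cfg Multiply U a (b + 2 + int n) (C + int n) \<leadsto> cfg Sweep U (a + 1) (b + 1 + int n) (C + int n - 1)"
    by (rule move) (simp_all add: header_x)
  also have "\<dots> \<leadsto> cfg SweepStay U (a + 2) (b + int n) (C + int n - 2)"
    by (rule move) simp_all
  also have "\<dots> \<leadsto> cfg Scan U (a + 2 + int n) b (C + int n - 2 - int (n div 2))"
    by (rule sweep)
  finally show ?thesis .
qed

lemma scan_digits:
  assumes "\<And>c. l' < c \<Longrightarrow> c \<le> l \<Longrightarrow> \<exists>d. U c = Digit d" "l' \<le> l"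
  shows "cfg Scan U i j l \<leadsto>
      cfg (if \<forall>c. l' < c \<and> c \<le> l \<longrightarrow> U c = Digit 9 then Scan else Found) U i j l'"
proof -
  have found: "cfg Found U i j k \<leadsto> cfg Found U i j l'" if "l' \<le> k" "k \<le> l" for k
    by (rule scan_left) (use assms that in fastforce)+
  show ?thesis
  proof (cases "\<forall>c. l' < c \<and> c \<le> l \<longrightarrow> U c = Digit 9")
    case True
    have "cfg Scan U i j l \<leadsto> cfg Scan U i j l'"
      by (rule scan_left) (use True assms(2) in auto)
    with True show ?thesis by simp
  next
    case False
    define Z where "Z = {c. l' < c \<and> c \<le> l \<and> U c \<noteq> Digit 9}"
    have Z: "finite Z" "Z \<noteq> {}"
      using False by (auto simp: Z_def intro: finite_subset[of _ "{l'<..l}"])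
    define k where "k = Max Z"
    have k: "l' < k" "k \<le> l" "U k \<noteq> Digit 9" using Max_in[OF Z] by (simp_all add: k_def Z_def)
    have above: "U c = Digit 9" if "k < c" "c \<le> l" for c
      using Max_ge[OF Z(1), of c] that k(1) by (force simp: k_def Z_def)
    have "cfg Scan U i j l \<leadsto> cfg Scan U i j k"
      by (rule scan_left) (use above k in auto)
    also have "\<dots> \<leadsto> cfg Found U i j (k - 1)"
      by (rule move) (use assms(1)[OF k(1,2)] k(3) in auto)
    also have "\<dots> \<leadsto> cfg Found U i j l'" using k by (intro found) auto
    finally show ?thesis by (simp only: if_not_P[OF False])
  qed
qed

abbreviation "stage n \<equiv> cfg Open (tape n (csum n)) (a + 1 + int n) (b + 1) (C + int n)"

lemma tape_Digit:
  assumes "M < c" "c < C + int (Suc n)" "c \<noteq> C + int p"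
  shows "\<exists>d. tape (Suc n) s c = Digit d"
  using assms T_bits[of c] by (auto simp: column_tape_def)

lemma tape_column:
  assumes "r \<le> n"
  shows "tape (Suc n) s (C + int r) = (if r = p then Aux else Digit) (s div 10 ^ (n - r) mod 10)"
proof -
  have "nat (C + int (Suc n) - 1 - (C + int r)) = n - r" using assms by simp
  with assms show ?thesis by (simp only: column_tape_def) simp
qed

lemma stage_scan:
  "stage n \<leadsto> cfg Scan (tape (Suc n) (csum (Suc n))) (a + 2 + int n) b (C + int n - 2 - int (n div 2))"
  using add_column sweep_back by (rule reaches_trans)

lemma resume:
  assumes "M \<le> l" "l \<le> C + int n"
  shows "cfg Resume (tape (Suc n) (csum (Suc n))) (a + 2 + int n) b (l + 1) \<leadsto> stage (Suc n)"
proof -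
  let ?U = "tape (Suc n) (csum (Suc n))"
  have "cfg Resume ?U (a + 2 + int n) b (l + 1) \<leadsto> cfg Resume ?U (a + 2 + int n) b (C + int (Suc n))"
    by (rule scan_right) (use assms fresh_tape[of _ "Suc n"] in auto)
  also have "\<dots> \<leadsto> stage (Suc n)"
    by (rule move) (use layout fresh_tape[of "C + int (Suc n)" "Suc n"] in auto)
  finally show ?thesis .
qed

text \<open>
  Between the start of the scan and the marked column the head meets a digit other than \<open>9\<close>, so it arrives there in phase
  \<^const>\<open>Found\<close> and picks up the digit.
\<close>
lemma settled_stage:
  assumes "settled n"
  shows "\<exists>i. stage n \<leadsto> cfg (Output (Digit (csum (Suc n) div 10 ^ (n - p) mod 10)))
    (tape (Suc n) (csum (Suc n))) i b (C + int p)"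
proof -
  let ?U = "tape (Suc n) (csum (Suc n))" and ?l = "C + int n - 2 - int (n div 2)"
  obtain r where r: "p < r" "int r \<le> int n - 2 - int (n div 2)" "csum (Suc n) div 10 ^ (n - r) mod 10 \<noteq> 9"
    using assms by (auto simp: digit_settled_def)
  have r_le: "r \<le> n" "p \<le> n" using r by linarith+
  have U_r: "?U (C + int r) \<noteq> Digit 9"
    using r r_le by (simp add: tape_column del: column_sum.simps)
  have U_p: "?U (C + int p) = Aux (csum (Suc n) div 10 ^ (n - p) mod 10)"
    using r_le by (simp add: tape_column del: column_sum.simps)
  have "stage n \<leadsto> cfg Scan ?U (a + 2 + int n) b ?l" by (rule stage_scan)
  also have "\<dots> \<leadsto> cfg (if \<forall>c. C + int p < c \<and> c \<le> ?l \<longrightarrow> ?U c = Digit 9 then Scan else Found)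
      ?U (a + 2 + int n) b (C + int p)"
    by (rule scan_digits) (use r layout in \<open>auto intro!: tape_Digit\<close>)
  also have "(if \<forall>c. C + int p < c \<and> c \<le> ?l \<longrightarrow> ?U c = Digit 9 then Scan else Found) = Found"
    using U_r r(1,2) by (intro if_not_P) (auto intro!: exI[of _ "C + int r"])
  also have "cfg Found ?U (a + 2 + int n) b (C + int p)
      \<leadsto> cfg (Output (Digit (csum (Suc n) div 10 ^ (n - p) mod 10))) ?U (a + 2 + int n) b (C + int p)"
    by (rule move) (simp_all add: U_p del: column_sum.simps)
  finally show ?thesis by blast
qed

text \<open>
  Either the scan starts at the marked column or to its right, and arrives there having seen only nines; or it starts to the left of it,
  never meets the mark, and ends at the separator of the input, whatever digits it has seen.
\<close>
lemma unsettled_stage: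
  assumes "\<not> settled n"
  shows "stage n \<leadsto> stage (Suc n)"
proof -
  let ?U = "tape (Suc n) (csum (Suc n))" and ?l = "C + int n - 2 - int (n div 2)"
  let ?cfg = "\<lambda>q. cfg q ?U (a + 2 + int n) b"
  have scan: "stage n \<leadsto> ?cfg Scan ?l" by (rule stage_scan)
  have M_le: "M \<le> ?l"
  proof -
    have "int n - int (n div 2) \<ge> 0" by simp
    then show ?thesis using layout by linarith
  qed
  show ?thesis
  proof (cases "C + int p \<le> ?l")
    case True
    have "p \<le> n" using True by linarith
    then have U_p: "\<exists>d. ?U (C + int p) = Aux d"
      by (simp add: tape_column del: column_sum.simps)
    have nines: "?U c = Digit 9" if "C + int p < c" "c \<le> ?l" for c
    proof -
      define r where "r = nat (c - C)"
      have r: "c = C + int r" "p < r" "int r \<le> int n - 2 - int (n div 2)"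
        using that by (auto simp: r_def)
      then have "csum (Suc n) div 10 ^ (n - r) mod 10 = 9"
        using assms by (auto simp: digit_settled_def simp del: column_sum.simps)
      moreover have "r \<le> n" using r(3) by linarith
      ultimately show ?thesis using r(1,2) by (simp add: tape_column del: column_sum.simps)
    qed
    note scan
    also have "?cfg Scan ?l \<leadsto> ?cfg Scan (C + int p)"
      by (rule scan_left) (use nines True in auto)
    also have "\<dots> \<leadsto> ?cfg Resume (C + int p + 1)"
      by (rule move) (use U_p in auto)
    also have "\<dots> \<leadsto> stage (Suc n)"
      using True layout by (intro resume) auto
    finally show ?thesis .
  next
    case False
    note scan
    also have "?cfg Scan ?l \<leadsto> ?cfg (if \<forall>c. M < c \<and> c \<le> ?l \<longrightarrow> ?U c = Digit 9 then Scan else Found) M"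
      by (rule scan_digits) (use False M_le in \<open>auto intro!: tape_Digit\<close>)
    also have "\<dots> \<leadsto> ?cfg Resume (M + 1)"
      by (rule move) (use layout T_sep in \<open>auto simp: column_tape_def\<close>)
    also have "\<dots> \<leadsto> stage (Suc n)"
      using layout by (intro resume) auto
    finally show ?thesis .
  qed
qed

text \<open>
  The machine stops at the first stage at which the digit is settled.
\<close>
lemma columns_output:
  assumes "settled n0"
  obtains n i where "settled n"
    "cfg (Table 0) T (- int p) 0 (C - 1) \<leadsto>
      cfg Halt (list_tape [Digit (csum (Suc n) div 10 ^ (n - p) mod 10)]) i b 0"
proof -
  define n where "n = (LEAST n. settled n)"
  have n: "settled n" unfolding n_def using assms by (rule LeastI)
  have not_settled: "\<not> settled k" if "k < n" for k
    using that unfolding n_def by (rule not_less_Least)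
  let ?U = "tape (Suc n) (csum (Suc n))" and ?d = "csum (Suc n) div 10 ^ (n - p) mod 10"
  have "stage 0 \<leadsto> stage k" if "k \<le> n" for k
    using that
  proof (induction k)
    case (Suc k)
    then have "stage 0 \<leadsto> stage k" by (intro Suc.IH) linarith
    also have "\<dots> \<leadsto> stage (Suc k)" using Suc.prems by (intro unsettled_stage not_settled) linarith
    finally show ?case .
  qed (rule reaches_refl)
  then have loop: "stage 0 \<leadsto> stage n" by blast
  obtain i where i: "stage n \<leadsto> cfg (Output (Digit ?d)) ?U i b (C + int p)"
    using settled_stage[OF n] by blast
  have p_n: "p < n" using n by (auto simp: digit_settled_def)
  have "cfg (Table 0) T (- int p) 0 (C - 1) \<leadsto> stage 0"
    using fill_columns by simp
  also note loop
  also note i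
  also have "cfg (Output (Digit ?d)) ?U i b (C + int p) \<leadsto> cfg Halt (list_tape [Digit ?d]) i b 0"
  proof (rule output_reaches[where r = "C + int (Suc n)"])
    fix k
    show "?U k \<noteq> Blank" if k: "0 \<le> k" "k < C + int (Suc n)"
    proof (cases "k < C - 1")
      case True
      then have "?U k = T k" by (simp only: column_tape_def if_True)
      moreover have "T k \<noteq> Blank"
      proof (cases "k < M")
        case False
        then show ?thesis using T_sep T_bits[of k] True by (cases "k = M") auto
      qed (use T_inside[of k] k in simp)
      ultimately show ?thesis by simp
    next
      case False
      then show ?thesis using k by (simp only: column_tape_def if_False if_True) simp
    qed
    show "?U k = Blank" if "k < 0"
      using that layout T_outside(1)[of k] by (simp add: column_tape_def del: column_sum.simps)
    show "?U k = Blank" if "C + int (Suc n) \<le> k"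
      using that p_n by (simp add: column_tape_def del: column_sum.simps)
  qed (use layout p_n in auto)
  finally show ?thesis using that n by blast
qed

end

section \<open>From inputs to outputs\<close>

lemma Blank_notin_binary: "Blank \<notin> set (binary n)"
  by (auto simp: in_set_conv_nth nth_binary)

context two_words begin

lemma terminates_withI:
  assumes "cfg FindSep (list_tape w) 0 0 0 \<leadsto> cfg Halt U i j l"
  shows "terminates_with mult_machine x y w U"
proof -
  have "initial_config mult_machine w = cfg FindSep (list_tape w) 0 0 0"
    by (simp add: initial_config_def mult_machine_def cfg_def)
  moreover have "state (cfg Halt U i j l) = terminal mult_machine" "tape3 (cfg Halt U i j l) = U"
    by (simp_all add: mult_machine_def cfg_def)
  ultimately show ?thesis
    using assms unfolding terminates_with_def reaches_def Let_def by metis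
qed

context
  fixes m :: nat and bits :: "symbol list" and w :: "symbol list"
  assumes bits: "set bits \<subseteq> {Digit 0, Digit 1}"
    and w: "w = binary m @ [Sep] @ bits"
begin

lemma start_of_table:
  "cfg FindSep (list_tape w) 0 0 0 \<leadsto> cfg (Table 0) (list_tape w) (- int m) 0 (int (length (binary m)) + 1)"
  and written_bits: "written (list_tape w) (int (length (binary m)) + 1) bits"
proof -
  have "written (list_tape w) 0 w" by simp
  then show "written (list_tape w) (int (length (binary m)) + 1) bits"
    and "cfg FindSep (list_tape w) 0 0 0
      \<leadsto> cfg (Table 0) (list_tape w) (- int m) 0 (int (length (binary m)) + 1)"
    by (auto simp: w list_tape_def intro!: read_input)
qed

lemma no_Blank_in_w: "Blank \<notin> set w"
  using bits Blank_notin_binary by (auto simp: w)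

lemma output_on_input_tape:
  assumes "0 \<le> l" "l \<le> int (length w)"
  shows "cfg (Output s) (list_tape w) i j l \<leadsto> cfg Halt (list_tape [s]) i j 0"
proof (rule output_reaches)
  fix k :: int assume "0 \<le> k" "k < int (length w)"
  then have "list_tape w k = w ! nat k" "nat k < length w" by (simp_all add: list_tape_def nat_less_iff)
  then show "list_tape w k \<noteq> Blank"
    using no_Blank_in_w nth_mem[of "nat k" w] by metis
qed (use assms in \<open>auto simp: list_tape_def\<close>)

end

lemma machine_prefix:
  assumes "\<forall>c\<in>set cs. c < 12" "m < length cs"
  shows "terminates_with mult_machine x y (binary m @ [Sep] @ table_bits (cs @ ds))
    (list_tape [table_symbol (cs ! m)])"
proof -
  let ?w = "binary m @ [Sep] @ table_bits (cs @ ds)" and ?l = "int (length (binary m)) + 1"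
  note w = set_table_bits[of "cs @ ds"] refl[of ?w]
  have T: "written (list_tape ?w) ?l (table_bits cs)"
    using written_bits[OF w] by simp
  obtain i l' where l': "?l \<le> l'" "l' \<le> ?l + int (length (table_bits cs))"
    and out: "cfg (Table 0) (list_tape ?w) (- int m) 0 ?l
      \<leadsto> cfg (Output (table_symbol (cs ! m))) (list_tape ?w) i 0 l'"
    using output_symbol[OF T assms] by blast
  note start_of_table[OF w]
  also note out
  also have "cfg (Output (table_symbol (cs ! m))) (list_tape ?w) i 0 l'
      \<leadsto> cfg Halt (list_tape [table_symbol (cs ! m)]) i 0 0"
    by (rule output_on_input_tape[OF w]) (use l' in simp_all)
  finally show ?thesis by (rule terminates_withI)
qed

lemma machine_zero:
  assumes "\<forall>c\<in>set cs. c < 12" "length cs \<le> m"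
  shows "terminates_with mult_machine x y (binary m @ [Sep] @ table_bits (cs @ [13]))
    (list_tape [Digit 0])"
proof -
  let ?w = "binary m @ [Sep] @ table_bits (cs @ [13])" and ?l = "int (length (binary m)) + 1"
  let ?k = "?l + int (length (table_bits cs))"
  note w = set_table_bits[of "cs @ [13]"] refl[of ?w]
  have T: "written (list_tape ?w) ?l (table_bits cs)"
      "written (list_tape ?w) ?k (replicate 13 (Digit 0))" "list_tape ?w (?k + int 13) = Digit 1"
    using written_bits[OF w] by simp_all
  note start_of_table[OF w]
  also have "cfg (Table 0) (list_tape ?w) (- int m) 0 ?l
      \<leadsto> cfg (Table 0) (list_tape ?w) (- int (m - length cs)) 0 ?k"
    by (rule skip_symbols[OF T(1) assms])
  also have "\<dots> \<leadsto> cfg (Table 13) (list_tape ?w) (- int (m - length cs)) 0 (?k + int 13)"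
    by (rule read_code[OF T(2)]) simp
  also have "\<dots> \<leadsto> cfg (Output (Digit 0)) (list_tape ?w) (- int (m - length cs)) 0 (?k + int 13)"
    by (rule move) (simp_all only: instruction.simps T(3), simp_all)
  also have "\<dots> \<leadsto> cfg Halt (list_tape [Digit 0]) (- int (m - length cs)) 0 0"
    by (rule output_on_input_tape[OF w]) simp_all
  finally show ?thesis by (rule terminates_withI)
qed

lemma machine_digit:
  assumes cs: "\<forall>c\<in>set cs. c < 12" "length cs \<le> m" "cs \<noteq> []"
    and bound: "\<And>n. column_sum D E n < 10 ^ Suc n"
    and settled: "digit_settled D E p n0" and p: "p = m - length cs + s"
  obtains n where "digit_settled D E p n"
    "terminates_with mult_machine x y (binary m @ [Sep] @ table_bits (cs @ replicate s 12))
       (list_tape [Digit (column_sum D E (Suc n) div 10 ^ (n - p) mod 10)])"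
proof -
  let ?bits = "table_bits (cs @ replicate s 12)" and ?M = "int (length (binary m))"
  let ?w = "binary m @ [Sep] @ ?bits"
  let ?k = "?M + 1 + int (length (table_bits cs))"
  define C where "C = ?M + int (length ?bits) + 2"
  note w = set_table_bits[of "cs @ replicate s 12"] refl[of ?w]
  note wb = written_bits[OF w]
  have T: "written (list_tape ?w) (?M + 1) (table_bits cs)"
      "written (list_tape ?w) ?k (table_bits (replicate s 12))"
    using wb by simp_all
  have "?bits \<noteq> []" using cs(3) by (cases cs) auto
  interpret columns x y a b D E "list_tape ?w" ?M C p
  proof
    show "?M + 1 < C - 1" using \<open>?bits \<noteq> []\<close> by (simp add: C_def del: table_bits_simps)
    show "list_tape ?w ?M = Sep" by (simp add: list_tape_def nth_append)
    show "list_tape ?w c \<in> {Digit 0, Digit 1}" if "?M < c" "c < C - 1" for c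
    proof -
      define r where "r = nat (c - ?M - 1)"
      have r: "r < length ?bits" "c = ?M + 1 + int r" using that by (auto simp: r_def C_def)
      then have "list_tape ?w c = ?bits ! r" using wb by (simp add: written_def del: table_bits_simps)
      then show ?thesis using set_table_bits[of "cs @ replicate s 12"] nth_mem[OF r(1)] by auto
    qed
    show "list_tape ?w c \<noteq> Blank" if "0 \<le> c" "c < ?M" for c
    proof -
      have c: "nat c < length (binary m)" using that by (simp add: nat_less_iff)
      then have "list_tape ?w c = binary m ! nat c" using that by (simp add: list_tape_def nth_append)
      then show ?thesis using Blank_notin_binary[of m] nth_mem[OF c] by metis
    qed
  qed (use bound in \<open>auto simp: list_tape_def C_def simp del: table_bits_simps\<close>)
  obtain n i where n: "digit_settled D E p n" and out:
    "cfg (Table 0) (list_tape ?w) (- int p) 0 (C - 1) \<leadsto>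
      cfg Halt (list_tape [Digit (csum (Suc n) div 10 ^ (n - p) mod 10)]) i b 0"
    using columns_output[OF settled] .
  note start_of_table[OF w]
  also have "cfg (Table 0) (list_tape ?w) (- int m) 0 (?M + 1)
      \<leadsto> cfg (Table 0) (list_tape ?w) (- int (m - length cs)) 0 ?k"
    by (rule skip_symbols[OF T(1) cs(1,2)])
  also have "\<dots> \<leadsto> cfg (Table 0) (list_tape ?w) (- int p) 0 (?k + int (length (table_bits (replicate s 12))))"
    unfolding p by (rule skip_padding[OF T(2)])
  also have "?k + int (length (table_bits (replicate s 12))) = C - 1" by (simp add: C_def)
  also note out
  finally show ?thesis using that[OF n] terminates_withI by blast
qed

end

section \<open>Weak computability of the product\<close>

lemma binary_bits: "set (binary n) \<subseteq> {Digit 0, Digit 1}"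
proof -
  have "n div 2 ^ k mod 2 = 0 \<or> n div 2 ^ k mod 2 = 1" for k by presburger
  then show ?thesis by (auto simp: in_set_conv_nth nth_binary)
qed

text \<open>
  Any list of bits that ends in \<open>1\<close> is a binary numeral, so \<open>h\<close> can be an arbitrary table.
\<close>
lemma bits_eq_binary:
  assumes "set u \<subseteq> {Digit 0, Digit 1}" "u \<noteq> []" "last u = Digit 1"
  shows "\<exists>h\<ge>1. binary h = u"
  using assms
proof (induction u)
  case (Cons s u)
  obtain c where c: "s = Digit c" "c < 2" using Cons.prems(1) by auto
  show ?case
  proof (cases "u = []")
    case True
    then have "binary 1 = s # u" using Cons.prems(3) by (simp add: binary.simps)
    then show ?thesis by blast
  next
    case False
    then obtain h where h: "1 \<le> h" "binary h = u" using Cons by auto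
    have "(2 * h + c) mod 2 = c" "(2 * h + c) div 2 = h" using c(2) by simp_all
    then have "binary (2 * h + c) = s # u" using h c by (subst binary.simps) simp
    then show ?thesis using h(1) by (intro exI[of _ "2 * h + c"]) simp
  qed
qed simp

lemma last_table_bits: "cs \<noteq> [] \<Longrightarrow> last (table_bits cs) = Digit 1"
  by (induction cs) (simp, case_tac cs, simp_all)

lemma table_bits_eq_Nil: "table_bits cs = [] \<longleftrightarrow> cs = []"
  by (cases cs) simp_all

lemma table_is_binary: "cs \<noteq> [] \<Longrightarrow> \<exists>h\<ge>1. binary h = table_bits cs"
  by (intro bits_eq_binary set_table_bits last_table_bits) (simp add: table_bits_eq_Nil)

lemma symbol_has_code:
  assumes "s \<in> A_R"
  shows "\<exists>c<12. table_symbol c = s"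
proof -
  consider n where "s = Digit n" "n \<le> 9" | "s = Minus" | "s = Sep"
    using assms by (auto simp: A_R_def)
  then show ?thesis
  proof cases
    case 1 then show ?thesis by (intro exI[of _ n]) (simp add: table_symbol_def)
  next
    case 2 then show ?thesis by (intro exI[of _ 10]) (simp add: table_symbol_def)
  next
    case 3 then show ?thesis by (intro exI[of _ 11]) (simp add: table_symbol_def)
  qed
qed

definition header :: "decimal \<Rightarrow> symbol list" where
  "header d = (if dec_neg d then [Minus] else []) @ binary (dec_order d)"

lemma header_symbols: "set (header d) \<subseteq> {Minus, Digit 0, Digit 1}"
  using binary_bits[of "dec_order d"] by (auto simp: header_def)

lemma encode_conv: "encode d = (header d @ [Sep]) \<frown> (\<lambda>i. Digit (leading_digit d i))"
  by (simp add: encode_def header_def leading_digit_def)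

lemma encode_header: "i < length (header d) \<Longrightarrow> encode d i = header d ! i"
  by (simp add: encode_conv conc_def nth_append)

lemma encode_sep: "encode d (length (header d)) = Sep"
  by (simp add: encode_conv conc_def nth_append)

lemma encode_digit: "encode d (Suc (length (header d)) + i) = Digit (leading_digit d i)"
  by (simp add: encode_conv conc_def)

lemma encode_cases:
  obtains (header) "i < length (header d)" "encode d i \<in> {Minus, Digit 0, Digit 1}"
  | (sep) "i = length (header d)" "encode d i = Sep"
  | (digit) j where "i = Suc (length (header d)) + j" "encode d i = Digit (leading_digit d j)"
proof -
  consider "i < length (header d)" | "i = length (header d)" | "Suc (length (header d)) \<le> i" by linarith
  then show thesis
  proof cases
    case 1
    then have "encode d i \<in> {Minus, Digit 0, Digit 1}"
      using nth_mem[OF 1] header_symbols[of d] by (simp only: encode_header) blast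
    with 1 show thesis by (rule header)
  next
    case 2
    then show thesis using sep encode_sep by simp
  next
    case 3
    then show thesis using digit[of "i - Suc (length (header d))"] encode_digit[of d] by (metis le_add_diff_inverse)
  qed
qed

lemma encode_in_A_R: "encode d i \<in> A_R"
proof (cases rule: encode_cases[of i d])
  case (digit j)
  then show ?thesis using digit_le[OF leading_digit_stream, of d j] by (simp add: A_R_def)
qed (auto simp: A_R_def)

lemma word_tape_encode:
  shows "word_tape (encode d) (int (length (header d))) = Sep"
    and "i < int (length (header d)) \<Longrightarrow> word_tape (encode d) i \<noteq> Sep"
    and "word_tape (encode d) (int (length (header d)) + 1 + int j) = Digit (leading_digit d j)"
    and "word_tape (encode d) i = Blank \<longleftrightarrow> i < 0"
proof -
  show "word_tape (encode d) (int (length (header d))) = Sep"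
    by (simp add: word_tape_def encode_sep)
  show "word_tape (encode d) i \<noteq> Sep" if "i < int (length (header d))"
  proof (cases "i < 0")
    case False
    then have "nat i < length (header d)" using that by simp
    then show ?thesis using False
      by (cases rule: encode_cases[of "nat i" d]) (auto simp: word_tape_def)
  qed (simp add: word_tape_def)
  have "nat (int (length (header d)) + 1 + int j) = Suc (length (header d)) + j" by simp
  then show "word_tape (encode d) (int (length (header d)) + 1 + int j) = Digit (leading_digit d j)"
    by (simp only: word_tape_def encode_digit) simp
  have "Blank \<notin> A_R" by (auto simp: A_R_def)
  then have "encode d (nat i) \<noteq> Blank" using encode_in_A_R[of d "nat i"] by auto
  then show "word_tape (encode d) i = Blank \<longleftrightarrow> i < 0"
    by (simp add: word_tape_def)
qed

lemma two_words_encode: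
  "two_words (encode d) (encode e) (int (length (header d))) (int (length (header e)))
    (leading_digit d) (leading_digit e)"
  by unfold_locales (use word_tape_encode in \<open>simp_all\<close>)

lemma prefix_codes:
  "\<exists>cs. length cs = L \<and> (\<forall>c\<in>set cs. c < 12) \<and> (\<forall>m<L. table_symbol (cs ! m) = encode d m)"
proof -
  obtain f where f: "\<And>m. f m < 12 \<and> table_symbol (f m) = encode d m"
    using symbol_has_code[OF encode_in_A_R] by metis
  then show ?thesis by (intro exI[of _ "map f [0..<L]"]) auto
qed

text \<open>
  Column \<open>r\<close> has the weight \<open>10\<close> to the power of the sum of the two orders, minus \<open>r\<close>. Because of leading
  zeros the order of the product can be any number up to that sum plus one; hence the leading digit of the product is in
  column \<open>s - 1\<close>, which may be column \<open>- 1\<close>, and only the digits after it are sure to be in columns from \<open>0\<close> on.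
\<close>
lemma product_digits:
  fixes d e :: decimal
  defines "z \<equiv> decimal_mult d e"
  defines "s \<equiv> dec_order d + dec_order e + 1 - dec_order z"
  shows "leading_digit z (Suc i) = factors.leading (leading_digit d) (leading_digit e) (i + s) mod 10"
proof -
  interpret factors "leading_digit d" "leading_digit e"
    by unfold_locales (rule leading_digit_stream)+
  let ?k = "dec_order d + dec_order e"
  have mag: "magnitude z = 10 ^ ?k * product"
    unfolding z_def magnitude_mult by (simp add: magnitude_def product_def power_add)
  have order: "dec_order z \<le> ?k + 1"
  proof (cases "dec_order z = 0")
    case False
    then have "10 ^ dec_order z \<le> 10 ^ ?k * product" unfolding mag[symmetric] by (intro magnitude_ge) simp
    also have "\<dots> < 10 ^ ?k * 10 ^ 2"
      using product_bounds by (intro mult_strict_left_mono) simp_all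
    also have "\<dots> = 10 ^ (?k + 2)" by (rule power_add[symmetric])
    finally have "dec_order z < ?k + 2" by (intro power_less_imp_less_exp[of "10::real"]) simp_all
    then show ?thesis by linarith
  qed simp
  have "product * 10 ^ (i + s) * 10 ^ ?k = stream_value (leading_digit z) * 10 ^ Suc i * 10 ^ ?k"
  proof -
    have exp: "10 ^ (i + s) * 10 ^ dec_order z = (10 ^ Suc i * 10 ^ ?k :: real)"
      using order by (simp add: s_def power_add[symmetric] del: power_Suc)
    have "product * 10 ^ (i + s) * 10 ^ ?k = 10 ^ (i + s) * magnitude z" by (simp add: mag)
    also have "\<dots> = stream_value (leading_digit z) * (10 ^ (i + s) * 10 ^ dec_order z)"
      by (simp add: magnitude_def)
    finally show ?thesis by (simp only: exp mult.assoc)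
  qed
  then have "product * 10 ^ (i + s) = stream_value (leading_digit z) * 10 ^ Suc i" by simp
  then show ?thesis
    using stream_digit[OF leading_digit_stream, of z "Suc i"] by (simp add: leading_def)
qed

text \<open>
  No finite number of digits of the factors reveals whether the product has a finite expansion. The case
  distinction is made here, in the choice of \<open>h\<close>.
\<close>
lemma product_computed:
  fixes d e :: decimal
  defines "z \<equiv> decimal_mult d e"
  shows "\<exists>h\<ge>1. \<forall>m. terminates_with mult_machine (encode d) (encode e)
    (binary m @ [Sep] @ binary h) (list_tape [encode z m])"
proof -
  interpret two_words "encode d" "encode e" "int (length (header d))" "int (length (header e))"
    "leading_digit d" "leading_digit e" by (rule two_words_encode)
  interpret factors "leading_digit d" "leading_digit e"
    by unfold_locales (rule leading_digit_stream)+
  let ?H = "length (header z)"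
  show ?thesis
  proof (cases "\<exists>n. \<forall>i\<ge>n. leading_digit z i = 0")
    case True
    then obtain n where n: "\<And>i. n \<le> i \<Longrightarrow> leading_digit z i = 0" by blast
    obtain cs where cs: "length cs = Suc ?H + n" "\<forall>c\<in>set cs. c < 12"
      "\<And>m. m < Suc ?H + n \<Longrightarrow> table_symbol (cs ! m) = encode z m"
      using prefix_codes[of "Suc ?H + n" z] by blast
    obtain h where h: "1 \<le> h" "binary h = table_bits (cs @ [13])"
      using table_is_binary[of "cs @ [13]"] by blast
    have "terminates_with mult_machine (encode d) (encode e) (binary m @ [Sep] @ binary h)
        (list_tape [encode z m])" for m
    proof (cases "m < length cs")
      case True
      then show ?thesis
        using machine_prefix[OF cs(2) True, of "[13]"] cs(1) cs(3)[of m] by (simp only: h(2))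
    next
      case False
      then have "length cs \<le> m" by simp
      define i where "i = m - length cs"
      have "m = Suc ?H + (n + i)" using \<open>length cs \<le> m\<close> cs(1) by (simp add: i_def)
      then have "encode z m = Digit 0" using encode_digit[of z "n + i"] n[of "n + i"] by simp
      then show ?thesis using machine_zero[OF cs(2) \<open>length cs \<le> m\<close>] by (simp only: h(2))
    qed
    with h(1) show ?thesis by blast
  next
    case False
    define s where "s = dec_order d + dec_order e + 1 - dec_order z"
    have digit: "leading_digit z (Suc i) = leading (i + s) mod 10" for i
      unfolding z_def s_def by (rule product_digits)
    have shift: "\<exists>i\<ge>n. leading i mod 10 \<noteq> c" if often: "\<forall>n. \<exists>i\<ge>n. leading_digit z i \<noteq> c" for c n
    proof -
      obtain i where i: "Suc n \<le> i" "leading_digit z i \<noteq> c" using often by blast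
      obtain j where j: "i = Suc j" using i(1) by (rule Suc_le_D[THEN exE])
      have "n \<le> j + s" "leading (j + s) mod 10 \<noteq> c" using i digit[of j] unfolding j by simp_all
      then show ?thesis by blast
    qed
    have nines: "\<exists>i\<ge>n. leading i mod 10 \<noteq> 9" for n
      using leading_digit_stream[of z] unfolding digit_stream_def by (intro shift) blast
    have zeros: "\<exists>i\<ge>n. leading i mod 10 \<noteq> 0" for n
      by (rule shift) (use False in blast)
    \<comment> \<open>header, separator and first digit: later digits are in columns from 0 on\<close>
    obtain cs where cs: "length cs = ?H + 2" "\<forall>c\<in>set cs. c < 12"
      "\<And>m. m < ?H + 2 \<Longrightarrow> table_symbol (cs ! m) = encode z m"
      using prefix_codes[of "?H + 2" z] by blast
    have "cs \<noteq> []" using cs(1) by auto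
    obtain h where h: "1 \<le> h" "binary h = table_bits (cs @ replicate s 12)"
      using table_is_binary[of "cs @ replicate s 12"] \<open>cs \<noteq> []\<close> by blast
    have "terminates_with mult_machine (encode d) (encode e) (binary m @ [Sep] @ binary h)
        (list_tape [encode z m])" for m
    proof (cases "m < length cs")
      case True
      then show ?thesis
        using machine_prefix[OF cs(2) True, of "replicate s 12"] cs(1) cs(3)[of m] by (simp only: h(2))
    next
      case False
      then have le: "length cs \<le> m" by simp
      define p where "p = m - length cs + s"
      obtain n0 where n0: "digit_settled (leading_digit d) (leading_digit e) p n0"
        using eventually_settled[OF nines zeros, of p] by blast
      obtain n where n: "digit_settled (leading_digit d) (leading_digit e) p n"
        "terminates_with mult_machine (encode d) (encode e)
          (binary m @ [Sep] @ table_bits (cs @ replicate s 12))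
          (list_tape [Digit (column_sum (leading_digit d) (leading_digit e) (Suc n) div 10 ^ (n - p) mod 10)])"
        using machine_digit[OF cs(2) le \<open>cs \<noteq> []\<close> column_sum_less n0 p_def] .
      have "m = Suc ?H + Suc (m - length cs)" using le cs(1) by simp
      then have "encode z m = Digit (leading p mod 10)"
        using encode_digit[of z "Suc (m - length cs)"] digit[of "m - length cs"] by (simp only: p_def)
      then show ?thesis using n(2) by (simp only: settled_correct[OF n(1)] h(2))
    qed
    with h(1) show ?thesis by blast
  qed
qed

theorem theorem4p7:
  shows "weakly_computable A_R X_R mult_R"
proof -
  have "is_encoding A_R X_R"
  proof -
    have "finite A_R" "A_R \<noteq> {}" "Blank \<notin> A_R" by (auto simp: A_R_def)
    then show ?thesis using encode_in_A_R by (auto simp: is_encoding_def X_R_def)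
  qed
  moreover have "is_operation X_R mult_R"
    by (simp add: is_operation_def mult_R_def X_R_def)
  moreover have "weakly_computes mult_machine X_R mult_R"
    unfolding weakly_computes_def
  proof (intro ballI)
    fix x y assume "x \<in> X_R" "y \<in> X_R"
    then have x: "encode (inv encode x) = x" and y: "encode (inv encode y) = y"
      unfolding X_R_def by (simp_all add: f_inv_into_f)
    show "\<exists>h\<ge>1. \<forall>m. terminates_with mult_machine x y (binary m @ [Sep] @ binary h)
        (list_tape [mult_R x y m])"
      using product_computed[of "inv encode x" "inv encode y"]
      unfolding x y mult_R_def .
  qed
  ultimately show ?thesis
    using is_machine_mult_machine by (auto simp: weakly_computable_def)
qed

end
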